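(* Consider the multi-output Gaussian convolution process with $q$ source outputs $f_1,\dots,f_q$ and one target output $f_t$ described in the context, with observation vectors $\bm{y}_1,\dots,\bm{y}_q,\bm{y}_t$ and $\bm{y}=(\bm{y}_1^T,\dots,\bm{y}_q^T,\bm{y}_t^T)^T$. Let $\mathcal{U}=\{1,2,\dots,h\}$ with $h\le q$, and suppose that $g_{it}(\bm{x})=0$ for all $i\in\mathcal{U}$ and all $\bm{x}\in\mathbb{R}^d$. Then for any new input $\bm{x}_*$ the predictive distribution of the new noisy target observation $y_t(\bm{x}_* )$ given $\bm{y}$ does not depend on the outputs $f_1,\dots,f_h$ (nor on their data $\bm{X}_1,\dots,\bm{X}_h,\bm{y}_1,\dots,\bm{y}_h$) and is $$p(y_t(\bm{x}_* )\mid \bm{y})=\mathcal{N}\left(\bm{k}_+^T\bm{C}_+^{-1}\bm{y}_+,\ \mathrm{cov}_{tt}^f(\bm{x}_*,\bm{x}_* )+\sigma_t^2-\bm{k}_+^T\bm{C}_+^{-1}\bm{k}_+\right),$$ where $\bm{k}_+=(\bm{K}_{h+1,*}^T,\dots,\bm{K}_{q,*}^T,\bm{K}_{t,*}^T)^T$, $\bm{y}_+=(\bm{y}_{h+1}^T,\dots,\bm{y}_q^T,\bm{y}_t^T)^T$, and $$\bm{C}_+=\begin{pmatrix}\bm{C}_{h+1,h+1}&\cdots&\bm{0}&\bm{C}_{h+1,t}\\ \vdots&\ddots&\vdots&\vdots\\ \bm{0}&\cdots&\bm{C}_{q,q}&\bm{C}_{q,t}\\ \bm{C}_{h+1,t}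^T&\cdots&\bm{C}_{q,t}^T&\bm{C}_{t,t}\end{pmatrix}.$$
   Context: Index sets: $\mathcal{I}^S=\{1,\dots,q\}$ (sources) and $\mathcal{I}=\{1,\dots,q,t\}$, where $t$ is the symbol labelling the target. Inputs lie in $\mathbb{R}^d$. Model: let $Z_1,\dots,Z_q,Z_t$ be independent zero-mean white Gaussian noise processes on $\mathbb{R}^d$, with $\mathrm{cov}(Z_j(\bm{x}),Z_j(\bm{x}'))=\delta(\bm{x}-\bm{x}')$ ($\delta$ the Dirac delta). Let $g_{ii}$ ($i\in\mathcal{I}^S$) and $g_{jt}$ ($j\in\mathcal{I}$) be real-valued square-integrable smoothing kernels on $\mathbb{R}^d$. With $\ast$ denoting convolution, $(g\ast Z)(\bm{x})=\int g(\bm{x}-\bm{u})Z(\bm{u})\,d\bm{u}$, set $$f_i=g_{ii}\ast Z_i\ (i\in\mathcal{I}^S),\qquad f_t=\sum_{j\in\mathcal{I}}g_{jt}\ast Z_j .$$ Equivalently, $(f_1,\dots,f_q,f_t)$ is a jointly Gaussian zero-mean process whose covariances $\mathrm{cov}_{ij}^f(\bm{x},\bm{x}')=\mathrm{cov}(f_i(\bm{x}),f_j(\bm{x}'))$ are, with $\bm{v}=\bm{x}-\bm{x}'$, $$\mathrm{cov}_{ii}^f(\bm{x},\bm{x}')=\int g_{ii}(\bm{u})g_{ii}(\bm{u}-\bm{v})\,d\bm{u},\quad \mathrm{cov}_{it}^f(\bm{x},\bm{x}')=\int g_{ii}(\bm{u})g_{it}(\bm{u}-\bm{v})\,d\bm{u}\quad(i\in\mathcal{I}^S),$$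 $$\mathrm{cov}_{tt}^f(\bm{x},\bm{x}')=\sum_{j\in\mathcal{I}}\int g_{jt}(\bm{u})g_{jt}(\bm{u}-\bm{v})\,d\bm{u},\qquad \mathrm{cov}_{ij}^f=0\ \text{ for } i\ne j\in\mathcal{I}^S .$$ Observations: for $i\in\mathcal{I}$, at input points $\bm{X}_i=(\bm{x}_{i,1},\dots,\bm{x}_{i,n_i})$ one observes $\bm{y}_i=(y_{i,1},\dots,y_{i,n_i})^T$ with $y_{i,a}=f_i(\bm{x}_{i,a})+\epsilon_{i,a}$, where the noises $\epsilon_{i,a}\sim\mathcal{N}(0,\sigma_i^2)$, $\sigma_i>0$, are mutually independent and independent of the $f$'s. A new target observation is $y_t(\bm{x}_* )=f_t(\bm{x}_* )+\epsilon_*$ with a fresh independent $\epsilon_*\sim\mathcal{N}(0,\sigma_t^2)$. Notation: $\bm{C}_{i,j}\in\mathbb{R}^{n_i\times n_j}$ is the covariance matrix between $\bm{y}_i$ and $\bm{y}_j$, i.e. its $(a,b)$ entry is $\mathrm{cov}_{ij}^f(\bm{x}_{i,a},\bm{x}_{j,b})$, plus $\sigma_i^2$ if $i=j$ and $a=b$. $\bm{K}_{i,*}=(\mathrm{cov}_{it}^f(\bm{x}_{i,1},\bm{x}_* ),\dots,\mathrm{cov}_{it}^f(\bm{x}_{i,n_i},\bm{x}_* ))^T$ for $i\in\mathcal{I}$. The predictive distribution means the conditional distribution of $y_t(\bm{x}_* )$ given $\bm{y}$ (input locations fixed). *)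

theory Defs
  imports "HOL-Probability.Probability" "Jordan_Normal_Form.Gauss_Jordan_Elimination"
begin

section \<open>Normal laws, Gaussian families and conditional distributions\<close>

text \<open>Meant for \<open>v \<ge> 0\<close>; the variance \<open>0\<close> gives a point mass, so that degenerate
  Gaussian variables (for instance those coming from a zero kernel) are covered.\<close>

definition normal_law :: "real \<Rightarrow> real \<Rightarrow> real measure" where
  "normal_law m v =
     (if v = 0 then return borel m else density lborel (\<lambda>x. ennreal (normal_density m (sqrt v) x)))"

definition covariance :: "'a measure \<Rightarrow> ('a \<Rightarrow> real) \<Rightarrow> ('a \<Rightarrow> real) \<Rightarrow> real" where
  "covariance M X Y =
     (\<integral>\<omega>. (X \<omega> - (\<integral>\<omega>'. X \<omega>' \<partial>M)) * (Y \<omega> - (\<integral>\<omega>'. Y \<omega>' \<partial>M)) \<partial>M)"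

definition centered_gaussian_family :: "'a measure \<Rightarrow> 's set \<Rightarrow> ('s \<Rightarrow> 'a \<Rightarrow> real) \<Rightarrow> bool" where
  "centered_gaussian_family M S X \<longleftrightarrow>
     (\<forall>s\<in>S. X s \<in> borel_measurable M) \<and>
     (\<forall>F c. finite F \<longrightarrow> F \<subseteq> S \<longrightarrow>
        (\<exists>v\<ge>0. distr M borel (\<lambda>\<omega>. \<Sum>s\<in>F. c s * X s \<omega>) = normal_law 0 v))"

text \<open>\<open>\<kappa>\<close> is a (regular) conditional distribution of the real random variable \<open>Y\<close> given the
  random element \<open>T\<close> of the measurable space \<open>N\<close>.\<close>

definition is_cond_distr ::
  "'a measure \<Rightarrow> 'b measure \<Rightarrow> ('a \<Rightarrow> 'b) \<Rightarrow> ('a \<Rightarrow> real) \<Rightarrow> ('b \<Rightarrow> real measure) \<Rightarrow> bool" where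
  "is_cond_distr M N T Y \<kappa> \<longleftrightarrow>
     T \<in> measurable M N \<and> Y \<in> borel_measurable M \<and> \<kappa> \<in> measurable N (prob_algebra borel) \<and>
     (\<forall>A\<in>sets borel. AE \<omega> in M.
        real_cond_exp M (vimage_algebra (space M) T N) (\<lambda>\<omega>. indicator A (Y \<omega>)) \<omega>
          = measure (\<kappa> (T \<omega>)) A)"


section \<open>White noise and the convolution process\<close>

definition square_int :: "(real^'d \<Rightarrow> real) set" where
  "square_int = {\<phi>. \<phi> \<in> borel_measurable lborel \<and> integrable lborel (\<lambda>u. (\<phi> u)\<^sup>2)}"

text \<open>White noise is a generalized process, given by its integrals \<open>W \<phi> = \<integral> \<phi>(u) Z(u) du\<close>
  against square-integrable \<open>\<phi>\<close>; the relation \<open>cov(Z(x), Z(x')) = \<delta>(x - x')\<close> means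
  \<open>cov(W \<phi>, W \<psi>) = \<integral> \<phi>(u) \<psi>(u) du\<close>.\<close>

definition white_noise :: "'a measure \<Rightarrow> ((real^'d \<Rightarrow> real) \<Rightarrow> 'a \<Rightarrow> real) \<Rightarrow> bool" where
  "white_noise M W \<longleftrightarrow>
     centered_gaussian_family M square_int W \<and>
     (\<forall>\<phi>\<in>square_int. \<forall>\<psi>\<in>square_int.
        covariance M (W \<phi>) (W \<psi>) = (\<integral>u. \<phi> u * \<psi> u \<partial>lborel))"

text \<open>\<open>(g * Z)(x) = \<integral> g(x - u) Z(u) du\<close>\<close>

definition noise_conv ::
  "(real^'d \<Rightarrow> real) \<Rightarrow> ((real^'d \<Rightarrow> real) \<Rightarrow> 'a \<Rightarrow> real) \<Rightarrow> real^'d \<Rightarrow> 'a \<Rightarrow> real" where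
  "noise_conv g W x = W (\<lambda>u. g (x - u))"

datatype label = Src nat | Tgt

definition outputs :: "nat \<Rightarrow> label set" where
  "outputs q = Src ` {1..q} \<union> {Tgt}"

text \<open>Throughout, \<open>gs i\<close> is the kernel \<open>g\<^sub>i\<^sub>i\<close> of source \<open>i\<close>, and \<open>gt j\<close> the kernel
  \<open>g\<^sub>j\<^sub>t\<close> by which the noise of \<open>j\<close> enters the target.\<close>

fun conv_output ::
  "nat \<Rightarrow> (nat \<Rightarrow> real^'d \<Rightarrow> real) \<Rightarrow> (label \<Rightarrow> real^'d \<Rightarrow> real) \<Rightarrow>
   (label \<Rightarrow> (real^'d \<Rightarrow> real) \<Rightarrow> 'a \<Rightarrow> real) \<Rightarrow> label \<Rightarrow> real^'d \<Rightarrow> 'a \<Rightarrow> real" where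
  "conv_output q gs gt Z (Src i) x \<omega> = noise_conv (gs i) (Z (Src i)) x \<omega>"
| "conv_output q gs gt Z Tgt x \<omega> = (\<Sum>j\<in>outputs q. noise_conv (gt j) (Z j) x \<omega>)"

locale gaussian_convolution_process = prob_space M
  for M :: "'a measure" +
  fixes q :: nat
    and gs :: "nat \<Rightarrow> real^'d \<Rightarrow> real"
    and gt :: "label \<Rightarrow> real^'d \<Rightarrow> real"
    and Z :: "label \<Rightarrow> (real^'d \<Rightarrow> real) \<Rightarrow> 'a \<Rightarrow> real"
  assumes source_kernels: "i \<in> {1..q} \<Longrightarrow> gs i \<in> square_int"
    and target_kernels: "j \<in> outputs q \<Longrightarrow> gt j \<in> square_int"
    and white_noises: "j \<in> outputs q \<Longrightarrow> white_noise M (Z j)"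
    and indep_white_noises:
      "indep_vars (\<lambda>_. PiM square_int (\<lambda>_. borel)) (\<lambda>j \<omega>. \<lambda>\<phi>\<in>square_int. Z j \<phi> \<omega>) (outputs q)"

text \<open>Observation points are numbered from \<open>0\<close>: output \<open>i\<close> is observed at \<open>X i 0\<close>, ...,
  \<open>X i (n i - 1)\<close>.\<close>

definition obs_idx :: "label set \<Rightarrow> (label \<Rightarrow> nat) \<Rightarrow> (label \<times> nat) set" where
  "obs_idx I n = (SIGMA i:I. {..<n i})"

text \<open>\<open>eps (i, a)\<close> is the noise of the \<open>a\<close>-th observation of output \<open>i\<close>, and \<open>eps_new\<close> the one
  of the new target observation; in the joint noise family the latter has the index \<open>None\<close>.\<close>

locale noisy_convolution_process = gaussian_convolution_process M q gs gt Z
  for M :: "'a measure" and q :: nat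
    and gs :: "nat \<Rightarrow> real^'d \<Rightarrow> real"
    and gt :: "label \<Rightarrow> real^'d \<Rightarrow> real"
    and Z :: "label \<Rightarrow> (real^'d \<Rightarrow> real) \<Rightarrow> 'a \<Rightarrow> real" +
  fixes n :: "label \<Rightarrow> nat"
    and \<sigma> :: "label \<Rightarrow> real"
    and eps :: "label \<times> nat \<Rightarrow> 'a \<Rightarrow> real"
    and eps_new :: "'a \<Rightarrow> real"
  assumes sigma_pos: "i \<in> outputs q \<Longrightarrow> \<sigma> i > 0"
    and eps_normal:
      "(i, a) \<in> obs_idx (outputs q) n \<Longrightarrow> distributed M lborel (eps (i, a)) (normal_density 0 (\<sigma> i))"
    and eps_new_normal: "distributed M lborel eps_new (normal_density 0 (\<sigma> Tgt))"
    and indep_noises: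
      "indep_vars (\<lambda>_. borel) (case_option eps_new eps) (insert None (Some ` obs_idx (outputs q) n))"
    and noises_indep_outputs:
      "indep_set
         (sets (vimage_algebra (space M)
            (\<lambda>\<omega>. \<lambda>k\<in>insert None (Some ` obs_idx (outputs q) n). case_option eps_new eps k \<omega>)
            (PiM (insert None (Some ` obs_idx (outputs q) n)) (\<lambda>_. borel))))
         (sets (vimage_algebra (space M)
            (\<lambda>\<omega>. \<lambda>(i, x)\<in>outputs q \<times> UNIV. conv_output q gs gt Z i x \<omega>)
            (PiM (outputs q \<times> UNIV) (\<lambda>_. borel))))"

definition obs ::
  "(label \<Rightarrow> real^'d \<Rightarrow> 'a \<Rightarrow> real) \<Rightarrow> (label \<Rightarrow> nat \<Rightarrow> real^'d) \<Rightarrow>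
   (label \<times> nat \<Rightarrow> 'a \<Rightarrow> real) \<Rightarrow> (label \<times> nat) set \<Rightarrow> 'a \<Rightarrow> label \<times> nat \<Rightarrow> real" where
  "obs f X eps J \<omega> = (\<lambda>(i, a)\<in>J. f i (X i a) \<omega> + eps (i, a) \<omega>)"


section \<open>Covariance functions\<close>

definition kernel_corr :: "(real^'d \<Rightarrow> real) \<Rightarrow> (real^'d \<Rightarrow> real) \<Rightarrow> real^'d \<Rightarrow> real" where
  "kernel_corr g g' v = (\<integral>u. g u * g' (u - v) \<partial>lborel)"

fun cov_f ::
  "nat \<Rightarrow> (nat \<Rightarrow> real^'d \<Rightarrow> real) \<Rightarrow> (label \<Rightarrow> real^'d \<Rightarrow> real) \<Rightarrow>
   label \<Rightarrow> label \<Rightarrow> real^'d \<Rightarrow> real^'d \<Rightarrow> real" where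
  "cov_f q gs gt (Src i) (Src j) x x' = (if i = j then kernel_corr (gs i) (gs i) (x - x') else 0)"
| "cov_f q gs gt (Src i) Tgt x x' = kernel_corr (gs i) (gt (Src i)) (x - x')"
| "cov_f q gs gt Tgt (Src i) x x' = kernel_corr (gs i) (gt (Src i)) (x' - x)"
| "cov_f q gs gt Tgt Tgt x x' = (\<Sum>j\<in>outputs q. kernel_corr (gt j) (gt j) (x - x'))"


lemma distr_lborel_reflect:
  "distr lborel borel (\<lambda>u. x - u) = (lborel :: (real^'d) measure)"
  using lborel_affine[of "-1" x, symmetric] by (simp add: density_1)

lemma square_int_reflect:
  fixes g :: "real^'d \<Rightarrow> real"
  assumes "g \<in> square_int"
  shows "(\<lambda>u. g (x - u)) \<in> square_int"
proof -
  have m [measurable]: "g \<in> borel_measurable borel"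
    and i: "integrable (distr lborel borel (\<lambda>u. x - u)) (\<lambda>u. (g u)\<^sup>2)"
    using assms by (auto simp: square_int_def distr_lborel_reflect)
  show ?thesis
    using i by (subst (asm) integrable_distr_eq) (auto simp: square_int_def)
qed

lemma integral_reflect_kernels:
  fixes g g' :: "real^'d \<Rightarrow> real"
  assumes "g \<in> square_int" "g' \<in> square_int"
  shows "(\<integral>u. g (x - u) * g' (x' - u) \<partial>lborel) = kernel_corr g g' (x - x')"
proof -
  have [measurable]: "g \<in> borel_measurable borel" "g' \<in> borel_measurable borel"
    using assms by (auto simp: square_int_def)
  have "kernel_corr g g' (x - x') =
      (\<integral>u. g u * g' (u - (x - x')) \<partial>distr lborel borel (\<lambda>u. x - u))"
    by (simp add: kernel_corr_def distr_lborel_reflect)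
  also have "\<dots> = (\<integral>u. g (x - u) * g' (x' - u) \<partial>lborel)"
    by (subst integral_distr) (auto simp: algebra_simps)
  finally show ?thesis ..
qed

lemma normal_law_moments:
  assumes "v \<ge> 0"
  shows "integrable (normal_law 0 v) (\<lambda>x. x)" "integrable (normal_law 0 v) (\<lambda>x. x\<^sup>2)"
    "(\<integral>x. x \<partial>normal_law 0 v) = 0"
proof -
  have *: "integrable (normal_law 0 v) (\<lambda>x. x) \<and> integrable (normal_law 0 v) (\<lambda>x. x\<^sup>2) \<and>
      (\<integral>x. x \<partial>normal_law 0 v) = 0"
  proof (cases "v = 0")
    case True
    have "integrable (return borel (0::real)) (\<lambda>x. x)" "integrable (return borel (0::real)) (\<lambda>x. x\<^sup>2)"
      by (auto intro!: integrableI_bounded simp: nn_integral_return)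
    moreover have "(\<integral>x. x \<partial>return borel (0::real)) = 0"
      by (rule integral_return) simp_all
    ultimately show ?thesis
      unfolding normal_law_def True by simp
  next
    case False
    define s where "s = sqrt v"
    have s: "s > 0" using assms False by (simp add: s_def)
    define D where "D = density lborel (\<lambda>x. ennreal (normal_density 0 s x))"
    have D: "integrable D f \<longleftrightarrow> integrable lborel (\<lambda>x. normal_density 0 s x * f x)"
      "(\<integral>x. f x \<partial>D) = (\<integral>x. normal_density 0 s x * f x \<partial>lborel)"
      if "f \<in> borel_measurable borel" for f :: "real \<Rightarrow> real"
      unfolding D_def using that
      by (auto simp: integrable_density integral_density intro!: AE_I2)
    have "integrable D (\<lambda>x. x)" "integrable D (\<lambda>x. x\<^sup>2)" "(\<integral>x. x \<partial>D) = 0"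
      using D[of "\<lambda>x. x"] D[of "\<lambda>x. x\<^sup>2"] integrable_normal_moment[OF s, of 0 1]
        integrable_normal_moment[OF s, of 0 2] integral_normal_moment_nz_1[OF s, of 0]
      by simp_all
    moreover have "normal_law 0 v = D"
      using False by (simp add: normal_law_def D_def s_def)
    ultimately show ?thesis by simp
  qed
  show "integrable (normal_law 0 v) (\<lambda>x. x)" "integrable (normal_law 0 v) (\<lambda>x. x\<^sup>2)"
    "(\<integral>x. x \<partial>normal_law 0 v) = 0" using * by auto
qed

context gaussian_convolution_process
begin

lemma white_noise_moments:
  assumes "j \<in> outputs q" "\<phi> \<in> square_int"
  shows "integrable M (Z j \<phi>)" "integrable M (\<lambda>\<omega>. (Z j \<phi> \<omega>)\<^sup>2)" "expectation (Z j \<phi>) = 0"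
proof -
  have fam: "centered_gaussian_family M square_int (Z j)"
    using white_noises[OF assms(1)] by (simp add: white_noise_def)
  have [measurable]: "Z j \<phi> \<in> borel_measurable M"
    using fam assms by (auto simp: centered_gaussian_family_def)
  have "\<exists>v\<ge>0. distr M borel (\<lambda>\<omega>. \<Sum>s\<in>{\<phi>}. 1 * Z j s \<omega>) = normal_law 0 v"
    using fam assms(2) unfolding centered_gaussian_family_def
    by (elim conjE allE[of _ "{\<phi>}"] allE[of _ "\<lambda>_. 1"]) auto
  then obtain v where v: "v \<ge> 0" "distr M borel (Z j \<phi>) = normal_law 0 v" by auto
  note mom = normal_law_moments[OF v(1), folded v(2)]
  show "integrable M (Z j \<phi>)" using mom(1) by (simp add: integrable_distr_eq)
  show "integrable M (\<lambda>\<omega>. (Z j \<phi> \<omega>)\<^sup>2)" using mom(2) by (simp add: integrable_distr_eq)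
  show "expectation (Z j \<phi>) = 0" using mom(3) by (simp add: integral_distr)
qed

lemma white_noise_prod:
  assumes "j \<in> outputs q" "k \<in> outputs q" "\<phi> \<in> square_int" "\<psi> \<in> square_int"
  shows "integrable M (\<lambda>\<omega>. Z j \<phi> \<omega> * Z k \<psi> \<omega>)"
    "expectation (\<lambda>\<omega>. Z j \<phi> \<omega> * Z k \<psi> \<omega>) = (if j = k then \<integral>u. \<phi> u * \<psi> u \<partial>lborel else 0)"
proof -
  note m1 = white_noise_moments[OF assms(1,3)] and m2 = white_noise_moments[OF assms(2,4)]
  have [measurable]: "Z j \<phi> \<in> borel_measurable M" "Z k \<psi> \<in> borel_measurable M"
    using m1 m2 by auto
  show "integrable M (\<lambda>\<omega>. Z j \<phi> \<omega> * Z k \<psi> \<omega>)"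
  proof (rule Bochner_Integration.integrable_bound[where f = "\<lambda>\<omega>. (Z j \<phi> \<omega>)\<^sup>2 + (Z k \<psi> \<omega>)\<^sup>2"])
    show "AE \<omega> in M. norm (Z j \<phi> \<omega> * Z k \<psi> \<omega>) \<le> norm ((Z j \<phi> \<omega>)\<^sup>2 + (Z k \<psi> \<omega>)\<^sup>2)"
    proof (intro AE_I2)
      fix \<omega>
      have "2 * \<bar>Z j \<phi> \<omega>\<bar> * \<bar>Z k \<psi> \<omega>\<bar> \<le> \<bar>Z j \<phi> \<omega>\<bar>\<^sup>2 + \<bar>Z k \<psi> \<omega>\<bar>\<^sup>2"
        by (rule sum_squares_bound)
      moreover have "0 \<le> \<bar>Z j \<phi> \<omega>\<bar> * \<bar>Z k \<psi> \<omega>\<bar>" by simp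
      ultimately have "\<bar>Z j \<phi> \<omega>\<bar> * \<bar>Z k \<psi> \<omega>\<bar> \<le> (Z j \<phi> \<omega>)\<^sup>2 + (Z k \<psi> \<omega>)\<^sup>2"
        unfolding power2_abs by linarith
      then show "norm (Z j \<phi> \<omega> * Z k \<psi> \<omega>) \<le> norm ((Z j \<phi> \<omega>)\<^sup>2 + (Z k \<psi> \<omega>)\<^sup>2)"
        by (simp add: abs_mult)
    qed
  qed (use m1 m2 in auto)
  show "expectation (\<lambda>\<omega>. Z j \<phi> \<omega> * Z k \<psi> \<omega>) = (if j = k then \<integral>u. \<phi> u * \<psi> u \<partial>lborel else 0)"
  proof (cases "j = k")
    case True
    have "covariance M (Z j \<phi>) (Z j \<psi>) = (\<integral>u. \<phi> u * \<psi> u \<partial>lborel)"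
      using white_noises[OF assms(1)] assms by (simp add: white_noise_def)
    then show ?thesis
      using m1(3) m2(3) True unfolding covariance_def by simp
  next
    case False
    let ?X = "\<lambda>j \<omega>. \<lambda>\<phi>\<in>square_int. Z j \<phi> \<omega>"
    have meas: "(\<lambda>w. w l \<theta>) \<in> borel_measurable (PiM {l} (\<lambda>_. PiM square_int (\<lambda>_. borel)))"
      if "\<theta> \<in> square_int" for l :: label and \<theta> :: "real^'d \<Rightarrow> real"
      by (rule measurable_compose[OF measurable_component_singleton[of l] measurable_component_singleton])
        (use that in auto)
    have "indep_var (PiM {j} (\<lambda>_. PiM square_int (\<lambda>_. borel))) (\<lambda>\<omega>. \<lambda>i\<in>{j}. ?X i \<omega>)
        (PiM {k} (\<lambda>_. PiM square_int (\<lambda>_. borel))) (\<lambda>\<omega>. \<lambda>i\<in>{k}. ?X i \<omega>)"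
      by (rule indep_var_restrict[OF indep_white_noises]) (use False assms in auto)
    then have "indep_var borel ((\<lambda>w. w j \<phi>) \<circ> (\<lambda>\<omega>. \<lambda>i\<in>{j}. ?X i \<omega>))
        borel ((\<lambda>w. w k \<psi>) \<circ> (\<lambda>\<omega>. \<lambda>i\<in>{k}. ?X i \<omega>))"
      by (rule indep_var_compose) (use assms meas in auto)
    then have "indep_var borel (Z j \<phi>) borel (Z k \<psi>)"
      using assms by (simp add: comp_def)
    then show ?thesis
      using indep_var_lebesgue_integral[of "Z j \<phi>" "Z k \<psi>"] m1 m2 False by simp
  qed
qed

lemma noise_conv_prod:
  assumes "j \<in> outputs q" "k \<in> outputs q" "g \<in> square_int" "g' \<in> square_int"
  shows "integrable M (\<lambda>\<omega>. noise_conv g (Z j) x \<omega> * noise_conv g' (Z k) x' \<omega>)"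
    "expectation (\<lambda>\<omega>. noise_conv g (Z j) x \<omega> * noise_conv g' (Z k) x' \<omega>) =
       (if j = k then kernel_corr g g' (x - x') else 0)"
  using white_noise_prod[OF assms(1,2) square_int_reflect[OF assms(3)] square_int_reflect[OF assms(4)],
      of x x']
    integral_reflect_kernels[OF assms(3,4), of x x']
  by (simp_all add: noise_conv_def)

lemma finite_outputs: "finite (outputs q)"
  by (simp add: outputs_def)

lemma expectation_conv_output:
  assumes "i \<in> outputs q"
  shows "expectation (conv_output q gs gt Z i x) = 0"
proof (cases i)
  case (Src k)
  then have "k \<in> {1..q}" using assms by (auto simp: outputs_def)
  moreover have "conv_output q gs gt Z i x = noise_conv (gs k) (Z i) x"
    using Src by (intro ext) simp
  ultimately show ?thesis
    using white_noise_moments(3)[OF assms square_int_reflect[OF source_kernels]]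
    by (simp add: noise_conv_def)
next
  case Tgt
  have "integrable M (noise_conv (gt j) (Z j) x) \<and> expectation (noise_conv (gt j) (Z j) x) = 0"
    if "j \<in> outputs q" for j
    using white_noise_moments(1,3)[OF that square_int_reflect[OF target_kernels[OF that]]]
    by (simp add: noise_conv_def)
  moreover have "conv_output q gs gt Z i x = (\<lambda>\<omega>. \<Sum>j\<in>outputs q. noise_conv (gt j) (Z j) x \<omega>)"
    using Tgt by (intro ext) simp
  ultimately show ?thesis
    by simp
qed

theorem covariance_conv_output:
  assumes "i \<in> outputs q" "j \<in> outputs q"
  shows "covariance M (conv_output q gs gt Z i x) (conv_output q gs gt Z j x') =
    cov_f q gs gt i j x x'"
proof -
  have cov: "covariance M (conv_output q gs gt Z i x) (conv_output q gs gt Z j x') =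
      expectation (\<lambda>\<omega>. conv_output q gs gt Z i x \<omega> * conv_output q gs gt Z j x' \<omega>)"
    using expectation_conv_output assms by (simp add: covariance_def)
  have src: "k \<in> {1..q}" if "Src k \<in> outputs q" for k
    using that by (auto simp: outputs_def)
  have st: "expectation (\<lambda>\<omega>. noise_conv (gs k) (Z (Src k)) y \<omega> * (\<Sum>j\<in>outputs q. noise_conv (gt j) (Z j) y' \<omega>))
      = kernel_corr (gs k) (gt (Src k)) (y - y')" if k: "Src k \<in> outputs q" for k y y'
    using noise_conv_prod[OF k _ source_kernels[OF src[OF k]] target_kernels] k finite_outputs
    by (simp add: sum_distrib_left)
  show ?thesis
  proof (cases i; cases j)
    fix k l assume "i = Src k" "j = Src l"
    then show ?thesis
      using cov noise_conv_prod(2)[OF assms source_kernels source_kernels] src assms by auto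
  next
    fix k assume "i = Src k" "j = Tgt"
    then show ?thesis using cov st assms by simp
  next
    fix k assume "i = Tgt" "j = Src k"
    then show ?thesis using cov st assms by (simp add: mult.commute)
  next
    assume ij: "i = Tgt" "j = Tgt"
    have "expectation (\<lambda>\<omega>. (\<Sum>j\<in>outputs q. noise_conv (gt j) (Z j) x \<omega>) *
        (\<Sum>j\<in>outputs q. noise_conv (gt j) (Z j) x' \<omega>)) =
      (\<Sum>k\<in>outputs q. \<Sum>l\<in>outputs q.
         expectation (\<lambda>\<omega>. noise_conv (gt k) (Z k) x \<omega> * noise_conv (gt l) (Z l) x' \<omega>))"
      using noise_conv_prod(1)[OF _ _ target_kernels target_kernels]
      by (simp add: sum_product)
    also have "\<dots> = (\<Sum>k\<in>outputs q. \<Sum>l\<in>outputs q.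
        if k = l then kernel_corr (gt k) (gt l) (x - x') else 0)"
      by (intro sum.cong refl noise_conv_prod(2) target_kernels)
    also have "\<dots> = (\<Sum>k\<in>outputs q. kernel_corr (gt k) (gt k) (x - x'))"
      using finite_outputs by simp
    finally show ?thesis using ij cov by simp
  qed
qed

end

section \<open>The predictive mean and variance\<close>

text \<open>In this section \<open>c\<close> is the covariance function of the outputs, and \<open>z\<close> the family of
  observed values.\<close>

type_synonym 'd cov_fun = "label \<Rightarrow> label \<Rightarrow> real^'d \<Rightarrow> real^'d \<Rightarrow> real"

definition C_mat ::
  "'d cov_fun \<Rightarrow> (label \<Rightarrow> nat) \<Rightarrow> (label \<Rightarrow> nat \<Rightarrow> real^'d) \<Rightarrow> (label \<Rightarrow> real) \<Rightarrow>
   label \<Rightarrow> label \<Rightarrow> real mat" where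
  "C_mat c n X \<sigma> i j =
     mat (n i) (n j) (\<lambda>(a, b). c i j (X i a) (X j b) + (if i = j \<and> a = b then (\<sigma> i)\<^sup>2 else 0))"

definition K_vec ::
  "'d cov_fun \<Rightarrow> (label \<Rightarrow> nat) \<Rightarrow> (label \<Rightarrow> nat \<Rightarrow> real^'d) \<Rightarrow> real^'d \<Rightarrow> label \<Rightarrow> real vec" where
  "K_vec c n X xs i = vec (n i) (\<lambda>a. c i Tgt (X i a) xs)"

definition src_plus :: "nat \<Rightarrow> nat \<Rightarrow> label list" where
  "src_plus h q = map Src [Suc h..<Suc q]"

definition idx_plus :: "nat \<Rightarrow> nat \<Rightarrow> label list" where
  "idx_plus h q = src_plus h q @ [Tgt]"

definition concat_vec :: "real vec list \<Rightarrow> real vec" where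
  "concat_vec vs = vec_of_list (concat (map list_of_vec vs))"

definition k_plus ::
  "nat \<Rightarrow> nat \<Rightarrow> 'd cov_fun \<Rightarrow> (label \<Rightarrow> nat) \<Rightarrow> (label \<Rightarrow> nat \<Rightarrow> real^'d) \<Rightarrow> real^'d \<Rightarrow> real vec" where
  "k_plus h q c n X xs = concat_vec (map (K_vec c n X xs) (idx_plus h q))"

definition y_plus :: "nat \<Rightarrow> nat \<Rightarrow> (label \<Rightarrow> nat) \<Rightarrow> (label \<times> nat \<Rightarrow> real) \<Rightarrow> real vec" where
  "y_plus h q n z = concat_vec (map (\<lambda>i. vec (n i) (\<lambda>a. z (i, a))) (idx_plus h q))"

definition C_plus ::
  "nat \<Rightarrow> nat \<Rightarrow> 'd cov_fun \<Rightarrow> (label \<Rightarrow> nat) \<Rightarrow> (label \<Rightarrow> nat \<Rightarrow> real^'d) \<Rightarrow> (label \<Rightarrow> real) \<Rightarrow>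
   real mat" where
  "C_plus h q c n X \<sigma> =
     (let S = diag_block_mat (map (\<lambda>i. C_mat c n X \<sigma> i i) (src_plus h q));
          B = mat_of_rows (n Tgt) (concat (map (\<lambda>i. rows (C_mat c n X \<sigma> i Tgt)) (src_plus h q)))
      in four_block_mat S B (transpose_mat B) (C_mat c n X \<sigma> Tgt Tgt))"

definition inv_mat :: "real mat \<Rightarrow> real mat" where
  "inv_mat A = the (mat_inverse A)"

definition pred_mean ::
  "nat \<Rightarrow> nat \<Rightarrow> 'd cov_fun \<Rightarrow> (label \<Rightarrow> nat) \<Rightarrow> (label \<Rightarrow> nat \<Rightarrow> real^'d) \<Rightarrow> (label \<Rightarrow> real) \<Rightarrow>
   real^'d \<Rightarrow> (label \<times> nat \<Rightarrow> real) \<Rightarrow> real" where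
  "pred_mean h q c n X \<sigma> xs z =
     k_plus h q c n X xs \<bullet> (inv_mat (C_plus h q c n X \<sigma>) *\<^sub>v y_plus h q n z)"

definition pred_var ::
  "nat \<Rightarrow> nat \<Rightarrow> 'd cov_fun \<Rightarrow> (label \<Rightarrow> nat) \<Rightarrow> (label \<Rightarrow> nat \<Rightarrow> real^'d) \<Rightarrow> (label \<Rightarrow> real) \<Rightarrow>
   real^'d \<Rightarrow> real" where
  "pred_var h q c n X \<sigma> xs =
     c Tgt Tgt xs xs + (\<sigma> Tgt)\<^sup>2
       - k_plus h q c n X xs \<bullet> (inv_mat (C_plus h q c n X \<sigma>) *\<^sub>v k_plus h q c n X xs)"

end

theory Submission
  imports Defs "Jordan_Normal_Form.Determinant"
begin

text \<open>
  Let \<open>w = C\<^sub>+\<^sup>-\<^sup>1 k\<^sub>+\<close>. The residual \<open>R = y\<^sub>t(x\<^sub>*) - w\<^sup>T y\<^sub>+\<close> is uncorrelated with \<open>y\<^sub>+\<close> by the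
  normal equations \<open>C\<^sub>+ w = k\<^sub>+\<close>, and with \<open>y\<^sub>1, ..., y\<^sub>h\<close> because \<open>g\<^sub>i\<^sub>t = 0\<close> makes these uncorrelated with all
  other observations. As everything is jointly Gaussian, \<open>R\<close> is independent of all the data, so that
  given the data \<open>y\<^sub>t(x\<^sub>*) = w\<^sup>T y\<^sub>+ + R\<close> is normal with mean \<open>w\<^sup>T y\<^sub>+\<close> and variance \<open>E R\<^sup>2\<close>. The
  observation noise bounds the covariance matrix from below, which makes \<open>C\<^sub>+\<close> invertible and \<open>E R\<^sup>2\<close> positive.

  Independence is obtained from the factorization of the joint characteristic function with only the
  one-dimensional uniqueness theorem, by trading one exponential at a time for an indicator function.
\<close>

section \<open>Normal laws\<close>

text \<open>Linear combinations may have variance zero (a zero kernel, or all coefficients zero), so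
  laws are identified through characteristic functions rather than densities, and point masses count
  as normal. The regression is carried out for an arbitrary set \<open>J\<close> of observations
  lying between the retained ones and all of them, with the weights \<open>w\<close> extended by
  zero to the discarded observations. The normal law obtained is the same for every such
  \<open>J\<close>; conditioning on all data or on the retained data alone therefore gives one and
  the same answer. That the formula itself reads only retained quantities is a separate congruence
  argument. The observation noise is independent of the outputs as a whole, so every combination of
  observations splits into an output part and an independent noise part. This split yields both
  joint Gaussianity and the lower bound on variances. The variance of the residual becomes the
  stated formula because \<open>R\<close> is orthogonal to the data: E R^2 = E (R * y_t), which is
  var y_t minus the product of \<open>w\<close> and \<open>k_plus\<close>.\<close>

lemma normal_law_pos:
  assumes "v > 0"
  shows "normal_law m v = density lborel (\<lambda>x. ennreal (normal_density m (sqrt v) x))"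
  using assms by (simp add: normal_law_def)

lemma sets_normal_law [simp, measurable_cong]: "sets (normal_law m v) = sets borel"
  by (simp add: normal_law_def)

lemma space_normal_law [simp]: "space (normal_law m v) = UNIV"
  by (simp add: normal_law_def)

lemma real_distribution_normal_law:
  assumes "v \<ge> 0"
  shows "real_distribution (normal_law m v)"
proof (cases "v = 0")
  case True
  then show ?thesis
    by (simp add: normal_law_def real_distribution_def real_distribution_axioms_def prob_space_return)
next
  case False
  with assms have "prob_space (normal_law m v)"
    by (simp add: normal_law_pos prob_space_normal_density)
  then show ?thesis
    by (simp add: real_distribution_def real_distribution_axioms_def)
qed

lemma distr_normal_law_affine:
  assumes "v \<ge> 0"
  shows "distr (normal_law m v) borel (\<lambda>x. \<beta> + \<alpha> * x) = normal_law (\<beta> + \<alpha> * m) (\<alpha>\<^sup>2 * v)"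
\<comment> \<open>In the degenerate case both sides are point masses;
  \<open>normal_density_affine\<close> needs a positive variance and a nonzero slope.\<close>
proof (cases "v = 0 \<or> \<alpha> = 0")
  case True
  interpret real_distribution "normal_law m v"
    by (rule real_distribution_normal_law) fact
  from True show ?thesis
  proof
    assume "v = 0"
    then show ?thesis
      by (simp add: normal_law_def distr_return)
  next
    assume "\<alpha> = 0"
    then show ?thesis
      using distr_const[of \<beta> borel] by (simp add: normal_law_def)
  qed
next
  case False
  then have v: "v > 0" and \<alpha>: "\<alpha> \<noteq> 0" using assms by auto
  interpret real_distribution "normal_law m v"
    by (rule real_distribution_normal_law) fact
  have "distributed (normal_law m v) lborel (\<lambda>x. x) (normal_density m (sqrt v))"
    using v by (auto simp: distributed_def normal_law_pos distr_id2)
  from normal_density_affine[OF this _ \<alpha>, of \<beta>] v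
  have "distr (normal_law m v) lborel (\<lambda>x. \<beta> + \<alpha> * x) =
      density lborel (normal_density (\<beta> + \<alpha> * m) (\<bar>\<alpha>\<bar> * sqrt v))"
    by (simp add: distributed_def)
  moreover have "\<bar>\<alpha>\<bar> * sqrt v = sqrt (\<alpha>\<^sup>2 * v)"
    by (simp add: real_sqrt_mult)
  moreover have "distr (normal_law m v) lborel (\<lambda>x. \<beta> + \<alpha> * x) = distr (normal_law m v) borel (\<lambda>x. \<beta> + \<alpha> * x)"
    by (rule distr_cong) auto
  ultimately show ?thesis
    using v \<alpha> by (simp add: normal_law_pos)
qed

lemma char_normal_law:
  assumes "v \<ge> 0"
  shows "char (normal_law 0 v) t = exp (- (v * t\<^sup>2) / 2)"
proof -
  \<comment> \<open>Scaling the standard normal law by \<open>sqrt v\<close> also covers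
    \<open>v = 0\<close>, where the slope vanishes.\<close>
  have s: "normal_law 0 v = distr std_normal_distribution borel (\<lambda>x. sqrt v * x)"
    using distr_normal_law_affine[of 1 0 0 "sqrt v"] assms by (simp add: normal_law_pos)
  have "char (normal_law 0 v) t = char std_normal_distribution (t * sqrt v)"
    unfolding s char_def by (subst integral_distr) (auto simp: mult_ac)
  also have "\<dots> = exp (- (v * t\<^sup>2) / 2)"
    using assms by (simp add: char_std_normal_distribution power_mult_distrib mult.commute)
  finally show ?thesis .
qed

lemma variance_normal_law:
  assumes "v \<ge> 0"
  shows "(\<integral>x. x\<^sup>2 \<partial>normal_law 0 v) = v"
proof (cases "v = 0")
  case True
  then show ?thesis by (simp add: normal_law_def integral_return)
next
  case False
  with assms have v: "v > 0" by simp
  have "(\<integral>x. x\<^sup>2 \<partial>normal_law 0 v) = (\<integral>x. normal_density 0 (sqrt v) x * (x - 0)^(2 * 1) \<partial>lborel)"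
    using v by (simp add: normal_law_pos integral_density)
  also have "\<dots> = v"
    by (subst integral_normal_moment_even) (use v in \<open>auto simp: field_simps\<close>)
  finally show ?thesis .
qed

lemma normal_lawI_char:
  assumes "real_distribution \<mu>" "v \<ge> 0" "\<And>t. char \<mu> t = exp (- (v * t\<^sup>2) / 2)"
  shows "\<mu> = normal_law 0 v"
  by (rule Levy_uniqueness) (use assms in \<open>auto simp: real_distribution_normal_law char_normal_law fun_eq_iff\<close>)

section \<open>Independence from characteristic functions\<close>

context prob_space
begin

lemma integrable_bounded_complex:
  fixes W :: "'a \<Rightarrow> complex"
  assumes "W \<in> borel_measurable M" "\<And>\<omega>. norm (W \<omega>) \<le> B"
  shows "integrable M W"
  by (rule integrable_const_bound[of _ B]) (use assms in auto)

text \<open>Levy uniqueness applied to the laws of \<open>X\<close> under \<open>M\<close> and under the density \<open>1 + W\<close>.\<close>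

lemma real_weight_vanishes:
  fixes W X :: "'a \<Rightarrow> real"
  assumes [measurable]: "W \<in> borel_measurable M" "X \<in> borel_measurable M"
    and bound: "\<And>\<omega>. \<bar>W \<omega>\<bar> \<le> 1"
    and vanish: "\<And>t. (CLINT \<omega>|M. complex_of_real (W \<omega>) * iexp (t * X \<omega>)) = 0"
    and A [measurable]: "A \<in> sets borel"
  shows "expectation (\<lambda>\<omega>. W \<omega> * indicator A (X \<omega>)) = 0"
proof -
  define D where "D = density M (\<lambda>\<omega>. ennreal (1 + W \<omega>))"
  have nonneg: "0 \<le> 1 + W \<omega>" for \<omega> using bound[of \<omega>] by linarith
  have int_W: "integrable M W"
    by (rule integrable_const_bound[of _ 1]) (use bound in auto)
  \<comment> \<open>The hypothesis at frequency 0 says that \<open>W\<close> has mean zero, so the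
    nonnegative density \<open>1 + W\<close> has total mass one.\<close>
  have EW: "expectation W = 0"
    using vanish[of 0] by simp
  have "emeasure D (space D) = 1"
    using EW int_W nonneg by (simp add: D_def emeasure_density nn_integral_eq_integral prob_space
        cong: nn_integral_cong)
  then interpret D: prob_space D by (rule prob_spaceI)
  have [measurable_cong, simp]: "sets D = sets M" by (simp add: D_def)
  have eq: "distr D borel X = distr M borel X"
  proof (rule Levy_uniqueness)
    show "real_distribution (distr D borel X)" by (rule D.real_distribution_distr) simp
    show "real_distribution (distr M borel X)" by (rule real_distribution_distr) simp
    show "char (distr D borel X) = char (distr M borel X)"
    proof
      fix t
      have i1: "integrable M (\<lambda>\<omega>. iexp (t * X \<omega>))"
        by (rule integrable_bounded_complex[of _ 1]) auto
      have i2: "integrable M (\<lambda>\<omega>. complex_of_real (W \<omega>) * iexp (t * X \<omega>))"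
        by (rule integrable_bounded_complex[of _ 1]) (use bound in \<open>auto simp: norm_mult\<close>)
      have "char (distr D borel X) t = (CLINT \<omega>|M. (1 + W \<omega>) *\<^sub>R iexp (t * X \<omega>))"
        unfolding char_def using nonneg by (simp add: integral_distr D_def integral_density)
      also have "\<dots> = (CLINT \<omega>|M. iexp (t * X \<omega>) + complex_of_real (W \<omega>) * iexp (t * X \<omega>))"
        by (simp add: scaleR_conv_of_real algebra_simps)
      also have "\<dots> = (CLINT \<omega>|M. iexp (t * X \<omega>))"
        using i1 i2 vanish[of t] by (subst Bochner_Integration.integral_add) auto
      finally show "char (distr D borel X) t = char (distr M borel X) t"
        unfolding char_def by (simp add: integral_distr)
    qed
  qed
  \<comment> \<open>Equality of the two laws, evaluated on \<open>A\<close>: the contribution of the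
    constant 1 cancels and the one of \<open>W\<close> remains.\<close>
  have "(\<integral>\<omega>. (1 + W \<omega>) * indicator A (X \<omega>) \<partial>M) = (\<integral>x. indicat_real A x \<partial>distr D borel X)"
    using nonneg by (subst integral_distr) (auto simp: D_def integral_density)
  also have "\<dots> = (\<integral>x. indicat_real A x \<partial>distr M borel X)"
    by (simp only: eq)
  also have "\<dots> = (\<integral>\<omega>. indicator A (X \<omega>) \<partial>M)"
    by (subst integral_distr) auto
  finally have "(\<integral>\<omega>. (1 + W \<omega>) * indicator A (X \<omega>) \<partial>M) = (\<integral>\<omega>. indicator A (X \<omega>) \<partial>M)" .
  moreover have "integrable M (\<lambda>\<omega>. indicat_real A (X \<omega>))"
    by (rule integrable_const_bound[of _ 1]) (auto simp: indicator_def)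
  moreover have "integrable M (\<lambda>\<omega>. W \<omega> * indicator A (X \<omega>))"
    by (rule integrable_const_bound[of _ 1]) (use bound in \<open>auto simp: indicator_def\<close>)
  ultimately show ?thesis
    by (simp add: distrib_right)
qed

text \<open>Reduces to the real and imaginary parts of \<open>W\<close>. These inherit the vanishing
  hypothesis because the conjugate of \<open>W\<close> has it too: conjugation only flips the sign
  of the frequency, and all frequencies are covered.\<close>

lemma complex_weight_vanishes:
  fixes W :: "'a \<Rightarrow> complex" and X :: "'a \<Rightarrow> real"
  assumes [measurable]: "W \<in> borel_measurable M" "X \<in> borel_measurable M"
    and bound: "\<And>\<omega>. norm (W \<omega>) \<le> 1"
    and vanish: "\<And>t. (CLINT \<omega>|M. W \<omega> * iexp (t * X \<omega>)) = 0"
    and A [measurable]: "A \<in> sets borel"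
  shows "(CLINT \<omega>|M. W \<omega> * indicator A (X \<omega>)) = 0"
proof -
  have int: "integrable M (\<lambda>\<omega>. W \<omega> * iexp (t * X \<omega>))" for t
    by (rule integrable_bounded_complex[of _ 1]) (use bound in \<open>auto simp: norm_mult\<close>)
  have [measurable]: "(\<lambda>\<omega>. cnj (W \<omega>)) \<in> borel_measurable M"
    using borel_measurable_continuous_onI[of cnj] by (rule measurable_compose[rotated]) (auto intro: continuous_intros)
  have int': "integrable M (\<lambda>\<omega>. cnj (W \<omega>) * iexp (t * X \<omega>))" for t
    by (rule integrable_bounded_complex[of _ 1]) (use bound in \<open>auto simp: norm_mult\<close>)
  have vanish': "(CLINT \<omega>|M. cnj (W \<omega>) * iexp (t * X \<omega>)) = 0" for t
  proof -
    have "(CLINT \<omega>|M. cnj (W \<omega>) * iexp (t * X \<omega>)) = (CLINT \<omega>|M. cnj (W \<omega> * iexp (- t * X \<omega>)))"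
      by (simp add: exp_cnj)
    also have "\<dots> = cnj (CLINT \<omega>|M. W \<omega> * iexp (- t * X \<omega>))"
      by (rule Bochner_Integration.integral_cnj)
    finally show ?thesis using vanish[of "- t"] by simp
  qed
  have Re: "expectation (\<lambda>\<omega>. Re (W \<omega>) * indicator A (X \<omega>)) = 0"
  proof (rule real_weight_vanishes)
    fix t
    have "(CLINT \<omega>|M. complex_of_real (Re (W \<omega>)) * iexp (t * X \<omega>)) =
        (CLINT \<omega>|M. (W \<omega> * iexp (t * X \<omega>) + cnj (W \<omega>) * iexp (t * X \<omega>)) / 2)"
      by (intro Bochner_Integration.integral_cong refl) (simp add: complex_add_cnj flip: distrib_right)
    then show "(CLINT \<omega>|M. complex_of_real (Re (W \<omega>)) * iexp (t * X \<omega>)) = 0"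
      using int[of t] int'[of t] vanish[of t] vanish'[of t] by simp
  qed (use bound abs_Re_le_cmod order_trans in \<open>auto\<close>, blast)
  have Im: "expectation (\<lambda>\<omega>. Im (W \<omega>) * indicator A (X \<omega>)) = 0"
  proof (rule real_weight_vanishes)
    fix t
    have "(CLINT \<omega>|M. complex_of_real (Im (W \<omega>)) * iexp (t * X \<omega>)) =
        (CLINT \<omega>|M. (W \<omega> * iexp (t * X \<omega>) - cnj (W \<omega>) * iexp (t * X \<omega>)) / (2 * \<i>))"
      by (intro Bochner_Integration.integral_cong refl) (simp add: complex_diff_cnj mult.left_commute[of "complex_of_real _" \<i>] flip: left_diff_distrib)
    then show "(CLINT \<omega>|M. complex_of_real (Im (W \<omega>)) * iexp (t * X \<omega>)) = 0"
      using int[of t] int'[of t] vanish[of t] vanish'[of t] by simp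
  qed (use bound abs_Im_le_cmod order_trans in \<open>auto\<close>, blast)
  have i: "integrable M (\<lambda>\<omega>. W \<omega> * indicator A (X \<omega>))"
    by (rule integrable_bounded_complex[of _ 1]) (use bound in \<open>auto simp: norm_mult indicator_def\<close>)
  show ?thesis
  proof (rule complex_eqI)
    show "Re (CLINT \<omega>|M. W \<omega> * indicator A (X \<omega>)) = Re 0"
    proof -
      have "Re (W \<omega> * indicator A (X \<omega>)) = Re (W \<omega>) * indicator A (X \<omega>)" for \<omega>
        by (cases "X \<omega> \<in> A") auto
      then show ?thesis
        using Re by (subst integral_Re[OF i, symmetric]) simp
    qed
    show "Im (CLINT \<omega>|M. W \<omega> * indicator A (X \<omega>)) = Im 0"
    proof -
      have "Im (W \<omega> * indicator A (X \<omega>)) = Im (W \<omega>) * indicator A (X \<omega>)" for \<omega>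
        by (cases "X \<omega> \<in> A") auto
      then show ?thesis
        using Im by (subst integral_Im[OF i, symmetric]) simp
    qed
  qed
qed

text \<open>Induction on \<open>J\<close> for all weights at once: the indicator belonging to one
  index is absorbed into the weight, which stays bounded by 1, and the induction hypothesis handles
  the remaining indices.\<close>

lemma complex_weight_vanishes_family:
  fixes W :: "'a \<Rightarrow> complex" and T :: "'s \<Rightarrow> 'a \<Rightarrow> real"
  assumes "finite J"
    and "W \<in> borel_measurable M" "\<And>j. j \<in> J \<Longrightarrow> T j \<in> borel_measurable M"
    and "\<And>\<omega>. norm (W \<omega>) \<le> 1"
    and "\<And>t. (CLINT \<omega>|M. W \<omega> * iexp (\<Sum>j\<in>J. t j * T j \<omega>)) = 0"
    and "\<And>j. j \<in> J \<Longrightarrow> B j \<in> sets borel"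
  shows "(CLINT \<omega>|M. W \<omega> * (\<Prod>j\<in>J. indicator (B j) (T j \<omega>))) = 0"
  using assms
proof (induction J arbitrary: W rule: finite_induct)
  case empty
  then show ?case by simp
next
  case (insert k J)
  note [measurable] = insert.prems(1) 
  have [measurable]: "T j \<in> borel_measurable M" "B j \<in> sets borel" if "j = k \<or> j \<in> J" for j
    using insert.prems(2,5) that by auto
  have "(CLINT \<omega>|M. (W \<omega> * indicator (B k) (T k \<omega>)) * (\<Prod>j\<in>J. indicator (B j) (T j \<omega>))) = 0"
  proof (rule insert.IH)
    show "(\<lambda>\<omega>. W \<omega> * indicator (B k) (T k \<omega>)) \<in> borel_measurable M"
      by measurable
    show "norm (W \<omega> * indicator (B k) (T k \<omega>)) \<le> 1" for \<omega>
      using insert.prems(3)[of \<omega>] by (simp add: indicator_def)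
    fix t
    \<comment> \<open>Now the exponentials of the other variables are part of the weight. They have
      modulus one, so the bound survives and only \<open>T k\<close> is left to treat by the
      one-dimensional lemma.\<close>
    have "(CLINT \<omega>|M. (W \<omega> * iexp (\<Sum>j\<in>J. t j * T j \<omega>)) * indicator (B k) (T k \<omega>)) = 0"
    proof (rule complex_weight_vanishes)
      show "(\<lambda>\<omega>. W \<omega> * iexp (\<Sum>j\<in>J. t j * T j \<omega>)) \<in> borel_measurable M"
        by measurable
      show "norm (W \<omega> * iexp (\<Sum>j\<in>J. t j * T j \<omega>)) \<le> 1" for \<omega>
        using insert.prems(3)[of \<omega>] by (simp add: norm_mult del: of_real_sum)
      fix s
      \<comment> \<open>The frequency \<open>s\<close> of \<open>T k\<close> and the frequencies
        \<open>t\<close> of the others are glued into one vector to match the hypothesis.\<close>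
      have "(\<Sum>j\<in>insert k J. (t(k := s)) j * T j \<omega>) = s * T k \<omega> + (\<Sum>j\<in>J. t j * T j \<omega>)" for \<omega>
        using insert.hyps by (subst sum.insert) (auto intro!: sum.cong)
      then have "(CLINT \<omega>|M. W \<omega> * iexp (s * T k \<omega> + (\<Sum>j\<in>J. t j * T j \<omega>))) = 0"
        using insert.prems(4)[of "t(k := s)"] by (simp del: of_real_sum)
      then show "(CLINT \<omega>|M. W \<omega> * iexp (\<Sum>j\<in>J. t j * T j \<omega>) * iexp (s * T k \<omega>)) = 0"
        by (simp add: exp_add distrib_left mult_ac del: of_real_sum)
    qed (auto)
    then show "(CLINT \<omega>|M. (W \<omega> * indicator (B k) (T k \<omega>)) * iexp (\<Sum>j\<in>J. t j * T j \<omega>)) = 0"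
      by (simp add: mult_ac del: of_real_sum)
  qed (use insert.prems in auto)
  then show ?case
    using insert.hyps by (simp add: mult_ac)
qed

text \<open>Preimages of Borel sets and of boxes are intersection-stable generators of the two
  sigma-algebras, so the product rule on rectangles is enough.\<close>

lemma indep_set_vimage_PiM_I:
  fixes R :: "'a \<Rightarrow> real" and T :: "'s \<Rightarrow> 'a \<Rightarrow> real"
  assumes J: "finite J"
    and R [measurable]: "R \<in> borel_measurable M"
    and T [measurable]: "\<And>j. j \<in> J \<Longrightarrow> T j \<in> borel_measurable M"
    and rect: "\<And>A B. A \<in> sets borel \<Longrightarrow> (\<And>j. j \<in> J \<Longrightarrow> B j \<in> sets borel) \<Longrightarrow>
      expectation (\<lambda>\<omega>. indicat_real A (R \<omega>) * (\<Prod>j\<in>J. indicat_real (B j) (T j \<omega>))) =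
      expectation (\<lambda>\<omega>. indicat_real A (R \<omega>)) * expectation (\<lambda>\<omega>. \<Prod>j\<in>J. indicat_real (B j) (T j \<omega>))"
  shows "indep_set (sets (vimage_algebra (space M) R borel))
    (sets (vimage_algebra (space M) (\<lambda>\<omega>. \<lambda>j\<in>J. T j \<omega>) (PiM J (\<lambda>_. borel))))"
proof -
  let ?T = "\<lambda>\<omega>. \<lambda>j\<in>J. T j \<omega>"
  let ?G1 = "{R -` A \<inter> space M | A. A \<in> sets borel}"
  let ?P = "prod_algebra J (\<lambda>_. borel :: real measure)"
  let ?G2 = "{?T -` E \<inter> space M | E. E \<in> ?P}"
  have Tm [measurable]: "?T \<in> measurable M (PiM J (\<lambda>_. borel))"
    by (rule measurable_restrict) (use T in auto)
  have P_sets: "E \<in> sets (PiM J (\<lambda>_. borel))" if "E \<in> ?P" for E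
    using that by (auto simp: sets_PiM)
  have "indep_set ?G1 ?G2"
    unfolding indep_sets2_eq
  proof (intro conjI ballI)
    show "?G1 \<subseteq> events" by auto
    show "?G2 \<subseteq> events" using P_sets by (auto intro: measurable_sets[OF Tm])
    fix a b assume "a \<in> ?G1" "b \<in> ?G2"
    then obtain A B where A: "A \<in> sets borel" "a = R -` A \<inter> space M"
      and B: "\<And>j. j \<in> J \<Longrightarrow> B j \<in> sets borel" "b = ?T -` (Pi\<^sub>E J B) \<inter> space M"
      by (auto simp: prod_algebra_eq_finite[OF J] Pi_iff)
    have b: "b = {\<omega>\<in>space M. \<forall>j\<in>J. T j \<omega> \<in> B j}"
      using B(2) by (auto simp: PiE_iff)
    have bE: "b \<in> events"
      unfolding b using B(1) J by measurable
    have ind_b: "(\<Prod>j\<in>J. indicat_real (B j) (T j \<omega>)) = indicator b \<omega>" if "\<omega> \<in> space M" for \<omega>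
      using J that by (auto simp: b indicator_def)
    have "prob a = expectation (\<lambda>\<omega>. indicat_real A (R \<omega>))"
      using A by (subst Bochner_Integration.integral_cong[of M M _ "indicat_real a"]) (auto simp: indicator_def)
    moreover have "prob b = expectation (\<lambda>\<omega>. \<Prod>j\<in>J. indicat_real (B j) (T j \<omega>))"
      using bE by (subst Bochner_Integration.integral_cong[OF refl ind_b]) auto
    moreover have "prob (a \<inter> b) = expectation (\<lambda>\<omega>. indicat_real A (R \<omega>) * (\<Prod>j\<in>J. indicat_real (B j) (T j \<omega>)))"
    proof -
      have "expectation (\<lambda>\<omega>. indicat_real A (R \<omega>) * (\<Prod>j\<in>J. indicat_real (B j) (T j \<omega>))) =
          expectation (indicat_real (a \<inter> b))"
        using A by (intro Bochner_Integration.integral_cong) (simp_all add: ind_b split: split_indicator)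
      then show ?thesis using A bE by auto
    qed
    ultimately show "prob (a \<inter> b) = prob a * prob b"
      using rect[OF A(1) B(1)] by simp
  qed
  then have "indep_set (sigma_sets (space M) ?G1) (sigma_sets (space M) ?G2)"
  proof (rule indep_set_sigma_sets)
    show "Int_stable ?G1"
    proof (rule Int_stableI)
      fix a b assume "a \<in> ?G1" "b \<in> ?G1"
      then obtain E F where "E \<in> sets borel" "a = R -` E \<inter> space M" "F \<in> sets borel" "b = R -` F \<inter> space M"
        by blast
      then have "a \<inter> b = R -` (E \<inter> F) \<inter> space M" "E \<inter> F \<in> sets borel"
        by (blast, simp only: sets.Int)
      then show "a \<inter> b \<in> ?G1" by blast
    qed
    show "Int_stable ?G2"
    proof (rule Int_stableI)
      fix a b assume "a \<in> ?G2" "b \<in> ?G2"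
      then obtain E F where EF: "E \<in> ?P" "a = ?T -` E \<inter> space M" "F \<in> ?P" "b = ?T -` F \<inter> space M"
        by blast
      have "a \<inter> b = ?T -` (E \<inter> F) \<inter> space M" unfolding EF(2,4) by auto
      moreover have "E \<inter> F \<in> ?P"
        using EF(1,3) by (rule Int_stableD[OF Int_stable_prod_algebra])
      ultimately show "a \<inter> b \<in> ?G2"
        by (intro CollectI exI[of _ "E \<inter> F"] conjI)
    qed
  qed
  \<comment> \<open>Taking preimages commutes with generating a sigma-algebra, so preimages of boxes
    generate everything that the vector of the \<open>T j\<close> generates.\<close>
  moreover have "{?T -` E \<inter> space M | E. E \<in> sets (PiM J (\<lambda>_. borel))} = sigma_sets (space M) ?G2"
    unfolding sets_PiM by (rule sigma_sets_vimage_commute) auto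
  moreover have "sets (vimage_algebra (space M) ?T (PiM J (\<lambda>_. borel))) =
      {?T -` E \<inter> space M | E. E \<in> sets (PiM J (\<lambda>_. borel))}"
    by (rule sets_vimage_algebra2) (auto simp: space_PiM)
  ultimately show ?thesis
    by (simp add: sets_vimage_algebra)
qed

text \<open>Two exchanges. The centred exponential of the \<open>T j\<close> annihilates all
  exponentials of \<open>R\<close>, hence also indicators of \<open>R\<close>; this says that the
  centred indicator of \<open>R\<close> annihilates all exponentials of the \<open>T j\<close>,
  hence also products of their indicators, which is the rectangle condition.\<close>

lemma indep_set_vimage_char:
  fixes R :: "'a \<Rightarrow> real" and T :: "'s \<Rightarrow> 'a \<Rightarrow> real"
  assumes J: "finite J"
    and R [measurable]: "R \<in> borel_measurable M"
    and T [measurable]: "\<And>j. j \<in> J \<Longrightarrow> T j \<in> borel_measurable M"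
    and char: "\<And>r t. (CLINT \<omega>|M. iexp (r * R \<omega> + (\<Sum>j\<in>J. t j * T j \<omega>))) =
      (CLINT \<omega>|M. iexp (r * R \<omega>)) * (CLINT \<omega>|M. iexp (\<Sum>j\<in>J. t j * T j \<omega>))"
  shows "indep_set (sets (vimage_algebra (space M) R borel))
    (sets (vimage_algebra (space M) (\<lambda>\<omega>. \<lambda>j\<in>J. T j \<omega>) (PiM J (\<lambda>_. borel))))"
proof (rule indep_set_vimage_PiM_I[OF J R T])
  fix A B assume [measurable]: "A \<in> sets (borel :: real measure)"
    and B [measurable]: "\<And>j. j \<in> J \<Longrightarrow> B j \<in> sets (borel :: real measure)"
  define a where "a = expectation (\<lambda>\<omega>. indicat_real A (R \<omega>))"
  have int_A: "integrable M (\<lambda>\<omega>. indicat_real A (R \<omega>))"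
    by (rule integrable_const_bound[of _ 1]) (auto simp: indicator_def)
  have "prob (R -` A \<inter> space M) = a"
    unfolding a_def
    by (subst Bochner_Integration.integral_cong[of M M _ "indicat_real (R -` A \<inter> space M)"])
      (auto simp: indicator_def)
  then have a01: "0 \<le> a" "a \<le> 1"
    using measure_nonneg prob_le_1 by metis+
  \<comment> \<open>The indicator is centred by its own mean \<open>a\<close>; since
    \<open>a\<close> lies in [0, 1], the weight is bounded by 1.\<close>
  define W where "W \<omega> = complex_of_real (indicator A (R \<omega>) - a)" for \<omega>
  have W1: "norm (W \<omega>) \<le> 1" for \<omega>
    using a01 unfolding W_def norm_of_real by (auto simp: indicator_def)
  have [measurable]: "W \<in> borel_measurable M" unfolding W_def[abs_def] by measurable
  have "(CLINT \<omega>|M. W \<omega> * (\<Prod>j\<in>J. indicator (B j) (T j \<omega>))) = 0"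
  proof (rule complex_weight_vanishes_family[OF J _ T W1])
    fix t
    let ?S = "\<lambda>\<omega>. \<Sum>j\<in>J. t j * T j \<omega>"
    define p where "p = (CLINT \<omega>|M. iexp (?S \<omega>))"
    have Sm [measurable]: "?S \<in> borel_measurable M" by measurable
    have i1: "integrable M (\<lambda>\<omega>. iexp (?S \<omega>))"
      by (rule integrable_bounded_complex[of _ 1]) (auto simp del: of_real_sum)
    have i2: "integrable M (\<lambda>\<omega>. iexp (?S \<omega>) * indicator A (R \<omega>))"
      by (rule integrable_bounded_complex[of _ 1]) (auto simp: norm_mult indicator_def simp del: of_real_sum)
    have i3: "integrable M (\<lambda>\<omega>. complex_of_real (indicator A (R \<omega>)))"
      using int_A by (rule integrable_of_real)
    have p1: "norm p \<le> 1"
    proof -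
      have "norm p \<le> (\<integral>\<omega>. norm (iexp (?S \<omega>)) \<partial>M)"
        unfolding p_def by (rule integral_norm_bound)
      then show ?thesis by (simp add: prob_space del: of_real_sum)
    qed
    \<comment> \<open>Subtracting the mean \<open>p\<close> turns the factorization hypothesis into
      a vanishing integral. Both terms have norm at most 1, so the factor 1/2 brings the weight
      within the required bound.\<close>
    have "(CLINT \<omega>|M. (iexp (?S \<omega>) - p) / 2 * indicator A (R \<omega>)) = 0"
    proof (rule complex_weight_vanishes)
      show "norm ((iexp (?S \<omega>) - p) / 2) \<le> 1" for \<omega>
        using norm_triangle_ineq4[of "iexp (?S \<omega>)" p] p1 by (simp add: norm_divide del: of_real_sum)
      fix r
      have i4: "integrable M (\<lambda>\<omega>. iexp (r * R \<omega> + ?S \<omega>))"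
        by (rule integrable_bounded_complex[of _ 1]) (auto simp del: of_real_sum of_real_add)
      have i5: "integrable M (\<lambda>\<omega>. iexp (r * R \<omega>))"
        by (rule integrable_bounded_complex[of _ 1]) (auto simp del: of_real_sum of_real_add)
      have "(CLINT \<omega>|M. (iexp (?S \<omega>) - p) / 2 * iexp (r * R \<omega>)) =
          (CLINT \<omega>|M. (iexp (r * R \<omega> + ?S \<omega>) - p * iexp (r * R \<omega>)) / 2)"
        by (intro Bochner_Integration.integral_cong refl)
          (simp add: exp_add field_simps del: of_real_sum)
      also have "\<dots> = ((CLINT \<omega>|M. iexp (r * R \<omega> + ?S \<omega>)) - p * (CLINT \<omega>|M. iexp (r * R \<omega>))) / 2"
        using i4 i5 by (simp del: of_real_sum of_real_add)
      also have "\<dots> = 0"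
        unfolding char[of r t] p_def by simp
      finally show "(CLINT \<omega>|M. (iexp (?S \<omega>) - p) / 2 * iexp (r * R \<omega>)) = 0" .
    qed (simp_all)
    moreover have "(CLINT \<omega>|M. (iexp (?S \<omega>) - p) / 2 * indicator A (R \<omega>)) =
        ((CLINT \<omega>|M. iexp (?S \<omega>) * indicator A (R \<omega>)) - p * a) / 2"
    proof -
      have "(CLINT \<omega>|M. (iexp (?S \<omega>) - p) / 2 * indicator A (R \<omega>)) =
         (CLINT \<omega>|M. (iexp (?S \<omega>) * indicator A (R \<omega>) - p * complex_of_real (indicator A (R \<omega>))) / 2)"
        by (intro Bochner_Integration.integral_cong refl) (simp add: field_simps indicator_def del: of_real_sum)
      also have "\<dots> = ((CLINT \<omega>|M. iexp (?S \<omega>) * indicator A (R \<omega>)) - p * (CLINT \<omega>|M. complex_of_real (indicator A (R \<omega>)))) / 2"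
        using i2 i3 by (simp del: of_real_sum of_real_indicator)
      finally show ?thesis
        unfolding a_def integral_complex_of_real .
    qed
    ultimately have *: "(CLINT \<omega>|M. iexp (?S \<omega>) * indicator A (R \<omega>)) = p * a"
      by simp
    have "(CLINT \<omega>|M. W \<omega> * iexp (?S \<omega>)) =
        (CLINT \<omega>|M. iexp (?S \<omega>) * indicator A (R \<omega>) - a * iexp (?S \<omega>))"
      by (intro Bochner_Integration.integral_cong refl)
        (simp add: W_def algebra_simps indicator_def del: of_real_sum)
    also have "\<dots> = 0"
      using i1 i2 * by (simp add: p_def del: of_real_sum)
    finally show "(CLINT \<omega>|M. W \<omega> * iexp (?S \<omega>)) = 0" .
  qed (use B in auto)
  moreover have "W \<omega> * (\<Prod>j\<in>J. indicator (B j) (T j \<omega>)) =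
      complex_of_real ((indicat_real A (R \<omega>) - a) * (\<Prod>j\<in>J. indicat_real (B j) (T j \<omega>)))" for \<omega>
    by (simp add: W_def of_real_indicator)
  ultimately have "expectation (\<lambda>\<omega>. (indicat_real A (R \<omega>) - a) * (\<Prod>j\<in>J. indicat_real (B j) (T j \<omega>))) = 0"
    by (simp only: integral_complex_of_real of_real_eq_0_iff)
  moreover have prod01: "0 \<le> (\<Prod>j\<in>J. indicat_real (B j) (T j \<omega>))" "(\<Prod>j\<in>J. indicat_real (B j) (T j \<omega>)) \<le> 1" for \<omega>
    by (auto intro!: prod_nonneg prod_le_1 simp: indicator_def)
  moreover have "integrable M (\<lambda>\<omega>. \<Prod>j\<in>J. indicat_real (B j) (T j \<omega>))"
    by (rule integrable_const_bound[of _ 1]) (use prod01 in auto)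
  moreover have "integrable M (\<lambda>\<omega>. indicator A (R \<omega>) * (\<Prod>j\<in>J. indicat_real (B j) (T j \<omega>)))"
    by (rule integrable_const_bound[of _ 1]) (use prod01 in \<open>auto simp: indicator_def\<close>)
  ultimately show "expectation (\<lambda>\<omega>. indicat_real A (R \<omega>) * (\<Prod>j\<in>J. indicat_real (B j) (T j \<omega>))) =
      expectation (\<lambda>\<omega>. indicat_real A (R \<omega>)) * expectation (\<lambda>\<omega>. \<Prod>j\<in>J. indicat_real (B j) (T j \<omega>))"
    by (simp add: a_def left_diff_distrib)
qed

text \<open>Independence makes the law of the pair of \<open>T\<close> and \<open>R\<close> a
  product; fixing the first coordinate at \<open>z\<close> then leaves \<open>R\<close> shifted by
  \<open>m z\<close>.\<close>

lemma is_cond_distr_add_indep: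
  fixes T :: "'a \<Rightarrow> 'b" and R :: "'a \<Rightarrow> real" and m :: "'b \<Rightarrow> real"
  assumes T [measurable]: "T \<in> measurable M N" and R [measurable]: "R \<in> borel_measurable M"
    and indep: "indep_set (sets (vimage_algebra (space M) R borel)) (sets (vimage_algebra (space M) T N))"
    and [measurable]: "m \<in> borel_measurable N"
  shows "is_cond_distr M N T (\<lambda>\<omega>. m (T \<omega>) + R \<omega>) (\<lambda>z. distr (distr M borel R) borel (\<lambda>r. m z + r))"
    (is "is_cond_distr M N T ?Y ?\<kappa>")
  unfolding is_cond_distr_def
proof (intro conjI ballI)
  show "T \<in> measurable M N" by fact
  show Y [measurable]: "?Y \<in> borel_measurable M" by simp
  interpret T: prob_space "distr M N T" by (rule prob_space_distr) simp
  interpret R: prob_space "distr M borel R" by (rule prob_space_distr) simp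
  interpret TR: pair_prob_space "distr M N T" "distr M borel R" ..
  have pair: "distr M N T \<Otimes>\<^sub>M distr M borel R = distr M (N \<Otimes>\<^sub>M borel) (\<lambda>\<omega>. (T \<omega>, R \<omega>))"
  proof (rule pair_measure_eqI)
    fix B C assume "B \<in> sets (distr M N T)" "C \<in> sets (distr M borel R)"
    then have [measurable]: "B \<in> sets N" "C \<in> sets borel" by auto
    have "R -` C \<inter> space M \<in> sets (vimage_algebra (space M) R borel)"
      "T -` B \<inter> space M \<in> sets (vimage_algebra (space M) T N)"
      by (auto intro!: in_vimage_algebra)
    then have "prob ((R -` C \<inter> space M) \<inter> (T -` B \<inter> space M)) =
        prob (R -` C \<inter> space M) * prob (T -` B \<inter> space M)"
      using indep unfolding indep_sets2_eq by auto
    moreover have "(\<lambda>\<omega>. (T \<omega>, R \<omega>)) -` (B \<times> C) \<inter> space M = (R -` C \<inter> space M) \<inter> (T -` B \<inter> space M)"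
      by auto
    ultimately show "emeasure (distr M N T) B * emeasure (distr M borel R) C =
        emeasure (distr M (N \<Otimes>\<^sub>M borel) (\<lambda>\<omega>. (T \<omega>, R \<omega>))) (B \<times> C)"
      by (simp add: emeasure_distr emeasure_eq_measure mult.commute flip: ennreal_mult)
  qed (auto intro: T.sigma_finite_measure_axioms R.sigma_finite_measure_axioms cong: sets_pair_measure_cong)
  have "(\<lambda>z. distr M borel R) \<in> N \<rightarrow>\<^sub>M prob_algebra borel"
    by (simp add: space_prob_algebra R.prob_space_axioms)
  then show \<kappa>: "?\<kappa> \<in> N \<rightarrow>\<^sub>M prob_algebra borel"
    by (rule measurable_distr_prob_space2) measurable
  let ?F = "vimage_algebra (space M) T N"
  have sub: "subalgebra M ?F"
    unfolding subalgebra_def using sets_image_in_sets[of M "space M" T N] by simp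
  interpret F: finite_measure_subalgebra M ?F
    by unfold_locales fact
  have F_T [measurable]: "T \<in> measurable ?F N"
    by (rule measurable_vimage_algebra1) (use measurable_space[OF T] in auto)
  fix A :: "real set" assume A [measurable]: "A \<in> sets borel"
  have [measurable]: "(\<lambda>z. measure (?\<kappa> z) A) \<in> borel_measurable N"
    using \<kappa> A by (auto intro: measure_measurable_prob_algebra2)
  show "AE \<omega> in M. real_cond_exp M ?F (\<lambda>\<omega>. indicator A (?Y \<omega>)) \<omega> = measure (?\<kappa> (T \<omega>)) A"
  proof (rule F.real_cond_exp_charact)
    show "integrable M (\<lambda>\<omega>. indicat_real A (?Y \<omega>))"
      by (rule integrable_const_bound[of _ 1]) (auto simp: indicator_def)
    show "integrable M (\<lambda>\<omega>. measure (?\<kappa> (T \<omega>)) A)"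
    proof (rule integrable_const_bound[of _ 1])
      have "prob_space (?\<kappa> z)" for z
        by (rule R.prob_space_distr) simp
      then show "AE \<omega> in M. norm (measure (?\<kappa> (T \<omega>)) A) \<le> 1"
        by (auto intro!: prob_space.prob_le_1)
    qed simp
    show "(\<lambda>\<omega>. measure (?\<kappa> (T \<omega>)) A) \<in> borel_measurable ?F" by measurable
    \<comment> \<open>A conditional expectation is characterized by its integrals over the sets of
      \<open>?F\<close>, all of which are preimages under \<open>T\<close>.\<close>
    fix E assume "E \<in> sets ?F"
    then obtain B where B [measurable]: "B \<in> sets N" and E: "E = T -` B \<inter> space M"
      using measurable_space[OF T] by (auto simp: sets_vimage_algebra2 Pi_iff)
    have \<kappa>_int: "measure (?\<kappa> z) A = (\<integral>r. indicator A (m z + r) \<partial>distr M borel R)" for z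
    proof -
      have "measure (?\<kappa> z) A = (\<integral>y. indicator A y \<partial>?\<kappa> z)"
        by simp
      also have "\<dots> = (\<integral>r. indicator A (m z + r) \<partial>distr M borel R)"
        by (rule integral_distr) auto
      finally show ?thesis .
    qed
    let ?g = "\<lambda>(z, r). indicator B z * indicator A (m z + r) :: real"
    have gm [measurable]: "?g \<in> borel_measurable (N \<Otimes>\<^sub>M borel)" by measurable
    have gi: "integrable (distr M N T \<Otimes>\<^sub>M distr M borel R) ?g"
      by (rule TR.integrable_const_bound[of _ 1]) (auto simp: indicator_def)
    \<comment> \<open>Pass to the product law and integrate out \<open>R\<close> first (Fubini); the
      inner integral is the kernel evaluated at \<open>A\<close>.\<close>
    have "(\<integral>\<omega>\<in>E. indicator A (?Y \<omega>) \<partial>M) = (\<integral>\<omega>. ?g (T \<omega>, R \<omega>) \<partial>M)"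
      unfolding set_lebesgue_integral_def
      by (intro Bochner_Integration.integral_cong) (auto simp: E indicator_def)
    also have "\<dots> = (\<integral>x. ?g x \<partial>distr M (N \<Otimes>\<^sub>M borel) (\<lambda>\<omega>. (T \<omega>, R \<omega>)))"
      by (subst integral_distr) auto
    also have "\<dots> = (\<integral>x. ?g x \<partial>(distr M N T \<Otimes>\<^sub>M distr M borel R))"
      by (simp only: pair)
    also have "\<dots> = (\<integral>z. (\<integral>r. ?g (z, r) \<partial>distr M borel R) \<partial>distr M N T)"
      by (rule TR.integral_fst'[OF gi, symmetric])
    also have "\<dots> = (\<integral>z. indicator B z * measure (?\<kappa> z) A \<partial>distr M N T)"
      by (simp add: \<kappa>_int)
    also have "\<dots> = (\<integral>\<omega>. indicator B (T \<omega>) * measure (?\<kappa> (T \<omega>)) A \<partial>M)"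
      by (subst integral_distr) auto
    also have "\<dots> = (\<integral>\<omega>\<in>E. measure (?\<kappa> (T \<omega>)) A \<partial>M)"
      unfolding set_lebesgue_integral_def
      by (intro Bochner_Integration.integral_cong) (auto simp: E indicator_def)
    finally show "(\<integral>\<omega>\<in>E. indicator A (?Y \<omega>) \<partial>M) = (\<integral>\<omega>\<in>E. measure (?\<kappa> (T \<omega>)) A \<partial>M)" .
  qed
qed


end

section \<open>Gaussian regression\<close>

context prob_space
begin

section \<open>Moments, and linear regression in a Gaussian family\<close>

lemma integrable_mult_of_squares:
  fixes f g :: "'a \<Rightarrow> real"
  assumes [measurable]: "f \<in> borel_measurable M" "g \<in> borel_measurable M"
    and "integrable M (\<lambda>\<omega>. (f \<omega>)\<^sup>2)" "integrable M (\<lambda>\<omega>. (g \<omega>)\<^sup>2)"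
  shows "integrable M (\<lambda>\<omega>. f \<omega> * g \<omega>)"
proof (rule Bochner_Integration.integrable_bound[where f = "\<lambda>\<omega>. (f \<omega>)\<^sup>2 + (g \<omega>)\<^sup>2"])
  show "AE \<omega> in M. norm (f \<omega> * g \<omega>) \<le> norm ((f \<omega>)\<^sup>2 + (g \<omega>)\<^sup>2)"
  proof (intro AE_I2)
    fix \<omega>
    have "2 * \<bar>f \<omega>\<bar> * \<bar>g \<omega>\<bar> \<le> \<bar>f \<omega>\<bar>\<^sup>2 + \<bar>g \<omega>\<bar>\<^sup>2"
      by (rule sum_squares_bound)
    moreover have "0 \<le> \<bar>f \<omega>\<bar> * \<bar>g \<omega>\<bar>" by simp
    ultimately have "\<bar>f \<omega>\<bar> * \<bar>g \<omega>\<bar> \<le> (f \<omega>)\<^sup>2 + (g \<omega>)\<^sup>2"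
      unfolding power2_abs by linarith
    then show "norm (f \<omega> * g \<omega>) \<le> norm ((f \<omega>)\<^sup>2 + (g \<omega>)\<^sup>2)"
      by (simp add: abs_mult)
  qed
qed (use assms in auto)

lemma normal_distr_moments:
  assumes [measurable]: "Y \<in> borel_measurable M" and v: "v \<ge> 0" and Y: "distr M borel Y = normal_law 0 v"
  shows "integrable M Y" "integrable M (\<lambda>\<omega>. (Y \<omega>)\<^sup>2)"
    "expectation Y = 0" "expectation (\<lambda>\<omega>. (Y \<omega>)\<^sup>2) = v"
    "(CLINT \<omega>|M. iexp (Y \<omega>)) = exp (- v / 2)"
proof -
  note mom = normal_law_moments[OF v, folded Y] variance_normal_law[OF v, folded Y]
  show "integrable M Y" using mom(1) by (simp add: integrable_distr_eq)
  show "integrable M (\<lambda>\<omega>. (Y \<omega>)\<^sup>2)" using mom(2) by (simp add: integrable_distr_eq)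
  show "expectation Y = 0" using mom(3) by (simp add: integral_distr)
  show "expectation (\<lambda>\<omega>. (Y \<omega>)\<^sup>2) = v" using mom(4) by (simp add: integral_distr)
  show "(CLINT \<omega>|M. iexp (Y \<omega>)) = exp (- v / 2)"
    using char_normal_law[OF v, of 1, folded Y] by (simp add: char_def integral_distr)
qed

text \<open>The residual \<open>R\<close> of the linear regression is jointly Gaussian with the regressors and
  uncorrelated with them, so the characteristic function of \<open>(R, U)\<close> factorizes.\<close>

theorem gaussian_regression:
  fixes Y :: "'a \<Rightarrow> real" and U :: "'s \<Rightarrow> 'a \<Rightarrow> real" and w :: "'s \<Rightarrow> real"
  assumes J: "finite J"
    and Y [measurable]: "Y \<in> borel_measurable M"
    and U [measurable]: "\<And>j. j \<in> J \<Longrightarrow> U j \<in> borel_measurable M"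
    and gauss: "\<And>r t. \<exists>v\<ge>0. distr M borel (\<lambda>\<omega>. r * Y \<omega> + (\<Sum>j\<in>J. t j * U j \<omega>)) = normal_law 0 v"
  defines "R \<equiv> \<lambda>\<omega>. Y \<omega> - (\<Sum>a\<in>J. w a * U a \<omega>)"
  assumes orth: "\<And>b. b \<in> J \<Longrightarrow> expectation (\<lambda>\<omega>. R \<omega> * U b \<omega>) = 0"
  shows "is_cond_distr M (PiM J (\<lambda>_. borel)) (\<lambda>\<omega>. \<lambda>a\<in>J. U a \<omega>) Y
    (\<lambda>z. normal_law (\<Sum>a\<in>J. w a * z a) (expectation (\<lambda>\<omega>. (R \<omega>)\<^sup>2)))"
proof -
  \<comment> \<open>Combinations of the residual and the regressors are again combinations of
    \<open>Y\<close> and the regressors, so \<open>gauss\<close> applies to them.\<close>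
  have combo: "r * R \<omega> + (\<Sum>j\<in>J. t j * U j \<omega>) = r * Y \<omega> + (\<Sum>j\<in>J. (t j - r * w j) * U j \<omega>)" for r t \<omega>
    by (simp add: R_def algebra_simps sum_subtractf sum_distrib_left)
  have R [measurable]: "R \<in> borel_measurable M"
    unfolding R_def by measurable
  \<comment> \<open>A centred normal law is determined by its second moment; hence so is the
    characteristic function of each combination.\<close>
  have comb: "integrable M (\<lambda>\<omega>. (r * R \<omega> + (\<Sum>j\<in>J. t j * U j \<omega>))\<^sup>2)"
    "distr M borel (\<lambda>\<omega>. r * R \<omega> + (\<Sum>j\<in>J. t j * U j \<omega>)) =
      normal_law 0 (expectation (\<lambda>\<omega>. (r * R \<omega> + (\<Sum>j\<in>J. t j * U j \<omega>))\<^sup>2))"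
    "(CLINT \<omega>|M. iexp (r * R \<omega> + (\<Sum>j\<in>J. t j * U j \<omega>))) =
      exp (- expectation (\<lambda>\<omega>. (r * R \<omega> + (\<Sum>j\<in>J. t j * U j \<omega>))\<^sup>2) / 2)" for r t
  proof -
    obtain v where v: "v \<ge> 0" "distr M borel (\<lambda>\<omega>. r * R \<omega> + (\<Sum>j\<in>J. t j * U j \<omega>)) = normal_law 0 v"
      using gauss[of r "\<lambda>j. t j - r * w j"] unfolding combo by blast
    note mom = normal_distr_moments[OF _ v]
    show "integrable M (\<lambda>\<omega>. (r * R \<omega> + (\<Sum>j\<in>J. t j * U j \<omega>))\<^sup>2)"
      by (rule mom(2)) measurable
    have "expectation (\<lambda>\<omega>. (r * R \<omega> + (\<Sum>j\<in>J. t j * U j \<omega>))\<^sup>2) = v"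
      by (rule mom(4)) measurable
    moreover have "(CLINT \<omega>|M. iexp (r * R \<omega> + (\<Sum>j\<in>J. t j * U j \<omega>))) = exp (- v / 2)"
      by (rule mom(5)) measurable
    ultimately show "distr M borel (\<lambda>\<omega>. r * R \<omega> + (\<Sum>j\<in>J. t j * U j \<omega>)) =
        normal_law 0 (expectation (\<lambda>\<omega>. (r * R \<omega> + (\<Sum>j\<in>J. t j * U j \<omega>))\<^sup>2))"
      "(CLINT \<omega>|M. iexp (r * R \<omega> + (\<Sum>j\<in>J. t j * U j \<omega>))) =
        exp (- expectation (\<lambda>\<omega>. (r * R \<omega> + (\<Sum>j\<in>J. t j * U j \<omega>))\<^sup>2) / 2)"
      using v by (simp_all only:)
  qed
  have R2: "integrable M (\<lambda>\<omega>. (R \<omega>)\<^sup>2)"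
    and R_distr: "distr M borel R = normal_law 0 (expectation (\<lambda>\<omega>. (R \<omega>)\<^sup>2))"
    using comb(1,2)[of 1 "\<lambda>_. 0"] by simp_all
  have U2: "integrable M (\<lambda>\<omega>. (U j \<omega>)\<^sup>2)" if "j \<in> J" for j
    using comb(1)[of 0 "\<lambda>i. if i = j then 1 else 0"] J that
    by (simp add: if_distrib[of "\<lambda>c. c * _"] cong: if_cong)
  have indep: "indep_set (sets (vimage_algebra (space M) R borel))
      (sets (vimage_algebra (space M) (\<lambda>\<omega>. \<lambda>j\<in>J. U j \<omega>) (PiM J (\<lambda>_. borel))))"
  proof (rule indep_set_vimage_char[OF J(1) R U])
    fix r t
    let ?S = "\<lambda>\<omega>. \<Sum>j\<in>J. t j * U j \<omega>"
    have Sm: "?S \<in> borel_measurable M" by measurable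
    have S2: "integrable M (\<lambda>\<omega>. (?S \<omega>)\<^sup>2)"
      using comb(1)[of 0 t] by simp
    have "expectation (\<lambda>\<omega>. R \<omega> * ?S \<omega>) = expectation (\<lambda>\<omega>. \<Sum>j\<in>J. t j * (R \<omega> * U j \<omega>))"
      by (simp add: sum_distrib_left mult_ac)
    also have "\<dots> = 0"
      using integrable_mult_of_squares[OF R U R2 U2] orth by simp
    finally have RS: "expectation (\<lambda>\<omega>. R \<omega> * ?S \<omega>) = 0" .
    have "expectation (\<lambda>\<omega>. (r * R \<omega> + ?S \<omega>)\<^sup>2) =
        expectation (\<lambda>\<omega>. (r\<^sup>2 * (R \<omega>)\<^sup>2 + (?S \<omega>)\<^sup>2) + 2 * r * (R \<omega> * ?S \<omega>))"
      by (simp add: power2_eq_square algebra_simps)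
    also have "\<dots> = expectation (\<lambda>\<omega>. r\<^sup>2 * (R \<omega>)\<^sup>2) + expectation (\<lambda>\<omega>. (?S \<omega>)\<^sup>2)"
      using R2 S2 integrable_mult_of_squares[OF R Sm R2 S2] RS by simp
    \<comment> \<open>Orthogonality removes the cross term, so second moments add, and the
      exponentials of them multiply.\<close>
    finally have var: "expectation (\<lambda>\<omega>. (r * R \<omega> + ?S \<omega>)\<^sup>2) =
        expectation (\<lambda>\<omega>. (r * R \<omega>)\<^sup>2) + expectation (\<lambda>\<omega>. (?S \<omega>)\<^sup>2)"
      by (simp add: power_mult_distrib)
    have "(CLINT \<omega>|M. iexp (r * R \<omega>)) = exp (- expectation (\<lambda>\<omega>. (r * R \<omega>)\<^sup>2) / 2)"
      using comb(3)[of r "\<lambda>_. 0"] by simp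
    moreover have "(CLINT \<omega>|M. iexp (?S \<omega>)) = exp (- expectation (\<lambda>\<omega>. (?S \<omega>)\<^sup>2) / 2)"
      using comb(3)[of 0 t] by simp
    ultimately show "(CLINT \<omega>|M. iexp (r * R \<omega> + ?S \<omega>)) = (CLINT \<omega>|M. iexp (r * R \<omega>)) * (CLINT \<omega>|M. iexp (?S \<omega>))"
      unfolding comb(3)[of r t] var by (simp add: exp_add[symmetric] add_divide_distrib diff_divide_distrib flip: exp_of_real)
  qed
  let ?T = "\<lambda>\<omega>. \<lambda>a\<in>J. U a \<omega>"
  have "?T \<in> measurable M (PiM J (\<lambda>_. borel))"
    by (rule measurable_restrict) (use U in auto)
  from is_cond_distr_add_indep[OF this R indep, of "\<lambda>z. \<Sum>a\<in>J. w a * z a"]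
  have "is_cond_distr M (PiM J (\<lambda>_. borel)) ?T (\<lambda>\<omega>. (\<Sum>a\<in>J. w a * ?T \<omega> a) + R \<omega>)
    (\<lambda>z. distr (normal_law 0 (expectation (\<lambda>\<omega>. (R \<omega>)\<^sup>2))) borel (\<lambda>r. (\<Sum>a\<in>J. w a * z a) + r))"
    by (simp add: R_distr)
  \<comment> \<open>An affine map of slope 1 moves the law of the residual to the fitted value;
    fitted value plus residual is \<open>Y\<close> by the definition of \<open>R\<close>.\<close>
  then show ?thesis
    using distr_normal_law_affine[of "expectation (\<lambda>\<omega>. (R \<omega>)\<^sup>2)" 0 _ 1] by (simp add: R_def)
qed

text \<open>Characteristic functions of independent summands multiply, which adds the variances and
  tolerates summands of variance zero.\<close>

lemma distr_sum_indep_normal: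
  assumes indep: "indep_vars (\<lambda>_. borel) Y I" and "finite I"
    and v: "\<And>i. i \<in> I \<Longrightarrow> v i \<ge> 0" "\<And>i. i \<in> I \<Longrightarrow> distr M borel (Y i) = normal_law 0 (v i)"
  shows "distr M borel (\<lambda>\<omega>. \<Sum>i\<in>I. Y i \<omega>) = normal_law 0 (\<Sum>i\<in>I. v i)"
proof (rule normal_lawI_char)
  have [measurable]: "Y i \<in> borel_measurable M" if "i \<in> I" for i
    using indep that by (auto simp: indep_vars_def)
  show "real_distribution (distr M borel (\<lambda>\<omega>. \<Sum>i\<in>I. Y i \<omega>))"
    by (rule real_distribution_distr) simp
  show "0 \<le> (\<Sum>i\<in>I. v i)" using v by (auto intro: sum_nonneg)
  fix t
  have "char (distr M borel (\<lambda>\<omega>. \<Sum>i\<in>I. Y i \<omega>)) t = (\<Prod>i\<in>I. complex_of_real (exp (- (v i * t\<^sup>2) / 2)))"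
    using v by (simp add: char_distr_sum[OF indep] char_normal_law)
  also have "\<dots> = complex_of_real (exp (\<Sum>i\<in>I. - (v i * t\<^sup>2) / 2))"
    using \<open>finite I\<close> by (simp add: exp_sum)
  also have "(\<Sum>i\<in>I. - (v i * t\<^sup>2) / 2) = - ((\<Sum>i\<in>I. v i) * t\<^sup>2) / 2"
    by (simp add: sum_distrib_right sum_divide_distrib sum_negf)
  finally show "char (distr M borel (\<lambda>\<omega>. \<Sum>i\<in>I. Y i \<omega>)) t = exp (- ((\<Sum>i\<in>I. v i) * t\<^sup>2) / 2)" .
qed

lemma distr_add_indep_normal:
  assumes indep: "indep_var borel Y1 borel Y2"
    and v: "v1 \<ge> 0" "distr M borel Y1 = normal_law 0 v1" "v2 \<ge> 0" "distr M borel Y2 = normal_law 0 v2"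
  shows "distr M borel (\<lambda>\<omega>. Y1 \<omega> + Y2 \<omega>) = normal_law 0 (v1 + v2)"
proof (rule normal_lawI_char)
  have [measurable]: "Y1 \<in> borel_measurable M" "Y2 \<in> borel_measurable M"
    using indep by (auto dest: indep_var_rv1 indep_var_rv2)
  show "real_distribution (distr M borel (\<lambda>\<omega>. Y1 \<omega> + Y2 \<omega>))"
    by (rule real_distribution_distr) simp
  fix t
  show "char (distr M borel (\<lambda>\<omega>. Y1 \<omega> + Y2 \<omega>)) t = exp (- ((v1 + v2) * t\<^sup>2) / 2)"
    using v by (simp add: char_distr_add[OF indep] char_normal_law distrib_right add_divide_distrib
        flip: exp_add of_real_mult)
qed (use v in simp)

text \<open>\<open>centered_gaussian_family\<close> speaks of sums over sets of indices, whereas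
  several observations may be taken at the same point. Repeated indices are merged by adding up the
  coefficients over each fibre of the map.\<close>

lemma gaussian_family_reindex:
  assumes fam: "centered_gaussian_family M S U" and K: "finite K" "\<And>k. k \<in> K \<Longrightarrow> \<phi> k \<in> S"
  shows "\<exists>v\<ge>0. distr M borel (\<lambda>\<omega>. \<Sum>k\<in>K. c k * U (\<phi> k) \<omega>) = normal_law 0 v"
proof -
  have "(\<Sum>k\<in>K. c k * U (\<phi> k) \<omega>) = (\<Sum>s\<in>\<phi> ` K. (\<Sum>k\<in>{k\<in>K. \<phi> k = s}. c k) * U s \<omega>)" for \<omega>
    unfolding sum.image_gen[OF K(1), of "\<lambda>k. c k * U (\<phi> k) \<omega>" \<phi>]
    by (intro sum.cong refl) (auto simp: sum_distrib_right intro!: sum.cong)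
  moreover have "finite (\<phi> ` K)" "\<phi> ` K \<subseteq> S" using K by auto
  ultimately show ?thesis
    using fam unfolding centered_gaussian_family_def by simp
qed

end

section \<open>The observations as a Gaussian family\<close>

context gaussian_convolution_process
begin

lemma measurable_white_noise [measurable]:
  assumes "j \<in> outputs q" "\<phi> \<in> square_int"
  shows "Z j \<phi> \<in> borel_measurable M"
  using white_noise_moments(1)[OF assms] by auto

lemma Src_in_outputs [simp]: "Src i \<in> outputs q \<longleftrightarrow> i \<in> {1..q}"
  by (auto simp: outputs_def)

lemma Tgt_in_outputs [simp]: "Tgt \<in> outputs q"
  by (simp add: outputs_def)

text \<open>Each output is a sum over all white noises, where the noises absent from a source enter
  with coefficient \<open>0\<close>.\<close>

lemma conv_output_eq_sum:
  assumes "i \<in> outputs q"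
  shows "\<exists>e \<phi>. (\<forall>j\<in>outputs q. \<phi> j \<in> square_int) \<and>
    (\<forall>\<omega>. conv_output q gs gt Z i x \<omega> = (\<Sum>j\<in>outputs q. e j * Z j (\<phi> j) \<omega>))"
proof (cases i)
  case (Src l)
  then have l: "l \<in> {1..q}" using assms by simp
  have "(\<lambda>u. gs l (x - u)) \<in> square_int"
    using l by (intro square_int_reflect source_kernels)
  moreover have "conv_output q gs gt Z i x \<omega> =
      (\<Sum>j\<in>outputs q. (if j = Src l then 1 else 0) * Z j (\<lambda>u. gs l (x - u)) \<omega>)" for \<omega>
    using finite_outputs assms Src by (simp add: noise_conv_def if_distrib[of "\<lambda>c. c * _"] cong: if_cong)
  ultimately show ?thesis
    by (intro exI[of _ "\<lambda>j. if j = Src l then 1 else 0"] exI[of _ "\<lambda>_ u. gs l (x - u)"]) blast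
next
  case Tgt
  have "(\<lambda>u. gt j (x - u)) \<in> square_int" if "j \<in> outputs q" for j
    using that by (intro square_int_reflect target_kernels)
  moreover have "conv_output q gs gt Z i x \<omega> = (\<Sum>j\<in>outputs q. 1 * Z j (\<lambda>u. gt j (x - u)) \<omega>)" for \<omega>
    using Tgt by (simp add: noise_conv_def)
  ultimately show ?thesis
    by (intro exI[of _ "\<lambda>_. 1"] exI[of _ "\<lambda>j u. gt j (x - u)"]) blast
qed

text \<open>Interchanging the sums groups a combination of outputs by white noise. Each group is
  normal because one white noise is a Gaussian family, and different groups are independent.\<close>

lemma gaussian_conv_outputs:
  "centered_gaussian_family M (outputs q \<times> UNIV) (\<lambda>(i, x). conv_output q gs gt Z i x)"
  unfolding centered_gaussian_family_def
proof (intro conjI ballI allI impI)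
  fix s :: "label \<times> (real^'d)" assume s: "s \<in> outputs q \<times> UNIV"
  then obtain e \<phi> where \<phi>: "\<And>j. j \<in> outputs q \<Longrightarrow> \<phi> j \<in> square_int"
    and eq: "\<And>\<omega>. conv_output q gs gt Z (fst s) (snd s) \<omega> = (\<Sum>j\<in>outputs q. e j * Z j (\<phi> j) \<omega>)"
    using conv_output_eq_sum[of "fst s" "snd s"] by (auto simp: mem_Times_iff)
  have "(\<lambda>\<omega>. \<Sum>j\<in>outputs q. e j * Z j (\<phi> j) \<omega>) \<in> borel_measurable M"
    using \<phi> by (intro borel_measurable_sum borel_measurable_times) auto
  then show "(case s of (i, x) \<Rightarrow> conv_output q gs gt Z i x) \<in> borel_measurable M"
    by (simp add: case_prod_beta eq[abs_def])
next
  fix K :: "(label \<times> (real^'d)) set" and c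
  assume K: "finite K" "K \<subseteq> outputs q \<times> UNIV"
  have "\<exists>e \<phi>. (\<forall>j\<in>outputs q. \<phi> j \<in> square_int) \<and>
      (\<forall>\<omega>. conv_output q gs gt Z (fst k) (snd k) \<omega> = (\<Sum>j\<in>outputs q. e j * Z j (\<phi> j) \<omega>))"
    if "k \<in> K" for k
    using that K(2) by (intro conv_output_eq_sum) auto
  then obtain e \<phi> where \<phi>: "\<And>k j. k \<in> K \<Longrightarrow> j \<in> outputs q \<Longrightarrow> \<phi> k j \<in> square_int"
    and eq: "\<And>k \<omega>. k \<in> K \<Longrightarrow>
      conv_output q gs gt Z (fst k) (snd k) \<omega> = (\<Sum>j\<in>outputs q. e k j * Z j (\<phi> k j) \<omega>)"
    by metis
  \<comment> \<open>Everything that the white noise \<open>j\<close> contributes to the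
    combination.\<close>
  define Y where "Y j \<omega> = (\<Sum>k\<in>K. (c k * e k j) * Z j (\<phi> k j) \<omega>)" for j \<omega>
  have sum_eq: "(\<Sum>k\<in>K. c k * (case k of (i, x) \<Rightarrow> conv_output q gs gt Z i x) \<omega>) = (\<Sum>j\<in>outputs q. Y j \<omega>)" for \<omega>
    unfolding Y_def sum.swap[of _ K]
    by (intro sum.cong refl) (simp add: case_prod_beta eq sum_distrib_left mult.assoc)
  have "\<exists>v\<ge>0. distr M borel (Y j) = normal_law 0 v" if "j \<in> outputs q" for j
    using white_noises[OF that] \<phi> that K(1) unfolding Y_def[abs_def] white_noise_def
    by (intro gaussian_family_reindex[where S = square_int]) auto
  then obtain v where v: "\<And>j. j \<in> outputs q \<Longrightarrow> v j \<ge> 0"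
    "\<And>j. j \<in> outputs q \<Longrightarrow> distr M borel (Y j) = normal_law 0 (v j)"
    by metis
  \<comment> \<open>Independence is assumed for the noises restricted to \<open>square_int\<close>.
    All arguments \<open>\<phi> k j\<close> lie in that set, so the restricted sums agree with
    \<open>Y\<close>.\<close>
  have "indep_vars (\<lambda>_. borel) (\<lambda>j \<omega>. \<Sum>k\<in>K. (c k * e k j) * (\<lambda>\<psi>\<in>square_int. Z j \<psi> \<omega>) (\<phi> k j)) (outputs q)"
  proof (rule indep_vars_compose2[OF indep_white_noises])
    fix j assume j: "j \<in> outputs q"
    show "(\<lambda>z. \<Sum>k\<in>K. (c k * e k j) * z (\<phi> k j)) \<in> borel_measurable (PiM square_int (\<lambda>_. borel))"
      using \<phi> j by (intro borel_measurable_sum borel_measurable_times measurable_component_singleton) auto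
  qed
  moreover have "(\<Sum>k\<in>K. (c k * e k j) * (\<lambda>\<psi>\<in>square_int. Z j \<psi> \<omega>) (\<phi> k j)) = Y j \<omega>" if "j \<in> outputs q" for j \<omega>
    unfolding Y_def using \<phi> that by (intro sum.cong) auto
  ultimately have "indep_vars (\<lambda>_. borel) Y (outputs q)"
    by (subst indep_vars_cong[where J = "outputs q" and Y = "\<lambda>j \<omega>. \<Sum>k\<in>K. (c k * e k j) * (\<lambda>\<psi>\<in>square_int. Z j \<psi> \<omega>) (\<phi> k j)" and N' = "\<lambda>_. borel"])
      auto
  from distr_sum_indep_normal[OF this finite_outputs v]
  show "\<exists>v\<ge>0. distr M borel (\<lambda>\<omega>. \<Sum>k\<in>K. c k * (case k of (i, x) \<Rightarrow> conv_output q gs gt Z i x) \<omega>) = normal_law 0 v"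
    unfolding sum_eq using v by (intro exI[of _ "\<Sum>j\<in>outputs q. v j"]) (auto intro: sum_nonneg)
qed

lemma conv_output_moments:
  assumes "i \<in> outputs q"
  shows "conv_output q gs gt Z i x \<in> borel_measurable M"
    "integrable M (\<lambda>\<omega>. (conv_output q gs gt Z i x \<omega>)\<^sup>2)"
proof -
  have fam: "centered_gaussian_family M (outputs q \<times> UNIV) (\<lambda>(i, x). conv_output q gs gt Z i x)"
    by (rule gaussian_conv_outputs)
  show m: "conv_output q gs gt Z i x \<in> borel_measurable M"
    using fam assms by (auto simp: centered_gaussian_family_def)
  obtain v where "v \<ge> 0" "distr M borel (conv_output q gs gt Z i x) = normal_law 0 v"
    using gaussian_family_reindex[OF fam, of "{()}" "\<lambda>_. (i, x)" "\<lambda>_. 1"] assms by auto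
  from normal_distr_moments(2)[OF m this]
  show "integrable M (\<lambda>\<omega>. (conv_output q gs gt Z i x \<omega>)\<^sup>2)" .
qed

end

text \<open>The index \<open>None\<close> stands for the new target observation.\<close>

fun joint_point :: "(label \<Rightarrow> nat \<Rightarrow> real^'d) \<Rightarrow> real^'d \<Rightarrow> (label \<times> nat) option \<Rightarrow> label \<times> (real^'d)" where
  "joint_point X xs None = (Tgt, xs)"
| "joint_point X xs (Some (i, a)) = (i, X i a)"

fun joint_sd :: "(label \<Rightarrow> real) \<Rightarrow> (label \<times> nat) option \<Rightarrow> real" where
  "joint_sd \<sigma> None = \<sigma> Tgt"
| "joint_sd \<sigma> (Some (i, a)) = \<sigma> i"

definition joint_idx :: "nat \<Rightarrow> (label \<Rightarrow> nat) \<Rightarrow> (label \<times> nat) option set" where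
  "joint_idx q n = insert None (Some ` obs_idx (outputs q) n)"

text \<open>The noise variance is attached to equality of indices, not of points: two observations
  at the same point, or the new observation at an old point, have independent noises. The covariance
  function \<open>c\<close> is left abstract so that the matrix identities do not involve the
  process.\<close>

definition joint_cov ::
  "(label \<Rightarrow> label \<Rightarrow> real^'d \<Rightarrow> real^'d \<Rightarrow> real) \<Rightarrow> (label \<Rightarrow> nat \<Rightarrow> real^'d) \<Rightarrow> real^'d \<Rightarrow> (label \<Rightarrow> real) \<Rightarrow>
   (label \<times> nat) option \<Rightarrow> (label \<times> nat) option \<Rightarrow> real" where
  "joint_cov c X xs \<sigma> k l =
     c (fst (joint_point X xs k)) (fst (joint_point X xs l)) (snd (joint_point X xs k)) (snd (joint_point X xs l))
       + (if k = l then (joint_sd \<sigma> k)\<^sup>2 else 0)"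

context noisy_convolution_process
begin

definition noise :: "(label \<times> nat) option \<Rightarrow> 'a \<Rightarrow> real" where
  "noise = case_option eps_new eps"

definition signal :: "(label \<Rightarrow> nat \<Rightarrow> real^'d) \<Rightarrow> real^'d \<Rightarrow> (label \<times> nat) option \<Rightarrow> 'a \<Rightarrow> real" where
  "signal X xs k = conv_output q gs gt Z (fst (joint_point X xs k)) (snd (joint_point X xs k))"

definition joint_obs :: "(label \<Rightarrow> nat \<Rightarrow> real^'d) \<Rightarrow> real^'d \<Rightarrow> (label \<times> nat) option \<Rightarrow> 'a \<Rightarrow> real" where
  "joint_obs X xs k \<omega> = signal X xs k \<omega> + noise k \<omega>"

section \<open>Laws and independence of the output part and the noise part\<close>

lemma finite_obs_idx: "finite (obs_idx (outputs q) n)"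
  unfolding obs_idx_def using finite_outputs by blast

lemma finite_joint_idx: "finite (joint_idx q n)"
  using finite_obs_idx by (simp add: joint_idx_def)

lemma joint_point_outputs:
  assumes "k \<in> joint_idx q n"
  shows "fst (joint_point X xs k) \<in> outputs q"
  using assms by (auto simp: joint_idx_def obs_idx_def)

lemma joint_sd_pos:
  assumes "k \<in> joint_idx q n"
  shows "joint_sd \<sigma> k > 0"
  using assms sigma_pos by (auto simp: joint_idx_def obs_idx_def)

lemma noise_distr:
  assumes "k \<in> joint_idx q n"
  shows "noise k \<in> borel_measurable M" "distr M borel (noise k) = normal_law 0 ((joint_sd \<sigma> k)\<^sup>2)"
proof -
  have d: "distributed M lborel (noise k) (normal_density 0 (joint_sd \<sigma> k))"
    using assms eps_normal eps_new_normal by (auto simp: joint_idx_def noise_def)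
  then show "noise k \<in> borel_measurable M"
    by (simp add: distributed_def)
  have "distr M borel (noise k) = distr M lborel (noise k)"
    by (rule distr_cong) auto
  then show "distr M borel (noise k) = normal_law 0 ((joint_sd \<sigma> k)\<^sup>2)"
    using d joint_sd_pos[OF assms] by (simp add: distributed_def normal_law_pos)
qed

lemma noise_moments:
  assumes "k \<in> joint_idx q n"
  shows "integrable M (noise k)" "integrable M (\<lambda>\<omega>. (noise k \<omega>)\<^sup>2)"
    "expectation (noise k) = 0" "expectation (\<lambda>\<omega>. (noise k \<omega>)\<^sup>2) = (joint_sd \<sigma> k)\<^sup>2"
  using normal_distr_moments[OF noise_distr(1)[OF assms] zero_le_power2 noise_distr(2)[OF assms]] by auto

lemma distr_signal_sum:
  assumes K: "K \<subseteq> joint_idx q n"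
  shows "\<exists>v\<ge>0. distr M borel (\<lambda>\<omega>. \<Sum>k\<in>K. c k * signal X xs k \<omega>) = normal_law 0 v"
proof -
  have "joint_point X xs k \<in> outputs q \<times> UNIV" if "k \<in> K" for k
    using joint_point_outputs K that by (auto simp: mem_Times_iff)
  from gaussian_family_reindex[OF gaussian_conv_outputs finite_subset[OF K finite_joint_idx] this, where c = c]
  show ?thesis by (simp add: signal_def case_prod_beta)
qed

lemma distr_noise_sum:
  assumes K: "K \<subseteq> joint_idx q n"
  shows "distr M borel (\<lambda>\<omega>. \<Sum>k\<in>K. c k * noise k \<omega>) = normal_law 0 (\<Sum>k\<in>K. (c k)\<^sup>2 * (joint_sd \<sigma> k)\<^sup>2)"
proof (rule distr_sum_indep_normal)
  show "finite K" using K finite_joint_idx by (rule finite_subset)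
  have "indep_vars (\<lambda>_. borel) noise K"
    using indep_noises K unfolding noise_def joint_idx_def by (rule indep_vars_subset)
  then show "indep_vars (\<lambda>_. borel) (\<lambda>k \<omega>. c k * noise k \<omega>) K"
    by (rule indep_vars_compose2) simp
  fix k assume "k \<in> K"
  then have k: "k \<in> joint_idx q n" using K by auto
  note [measurable] = noise_distr(1)[OF k]
  show "0 \<le> (c k)\<^sup>2 * (joint_sd \<sigma> k)\<^sup>2" by simp
  have "distr M borel (\<lambda>\<omega>. c k * noise k \<omega>) = distr (distr M borel (noise k)) borel (\<lambda>x. 0 + c k * x)"
    by (simp add: distr_distr comp_def)
  then show "distr M borel (\<lambda>\<omega>. c k * noise k \<omega>) = normal_law 0 ((c k)\<^sup>2 * (joint_sd \<sigma> k)\<^sup>2)"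
    unfolding noise_distr(2)[OF k] using distr_normal_law_affine[of "(joint_sd \<sigma> k)\<^sup>2" 0 0 "c k"] by simp
qed

lemma noise_second_moment:
  assumes k: "k \<in> joint_idx q n" and l: "l \<in> joint_idx q n"
  shows "expectation (\<lambda>\<omega>. noise k \<omega> * noise l \<omega>) = (if k = l then (joint_sd \<sigma> k)\<^sup>2 else 0)"
proof (cases "k = l")
  case True
  then show ?thesis using noise_moments(4)[OF l] l by (simp add: power2_eq_square)
next
  case False
  \<comment> \<open>Independence of the pair is extracted from \<open>indep_vars_sum\<close> by
    using a sum with the single term \<open>noise l\<close>.\<close>
  have "indep_vars (\<lambda>_. borel) noise (insert k {l})"
    using indep_noises k l unfolding noise_def joint_idx_def by (rule_tac indep_vars_subset) auto
  then have "indep_var borel (noise k) borel (\<lambda>\<omega>. \<Sum>i\<in>{l}. noise i \<omega>)"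
    using False by (intro indep_vars_sum) auto
  then have "indep_var borel (noise k) borel (noise l)" by simp
  then show ?thesis
    using False indep_var_lebesgue_integral[of "noise k" "noise l"] noise_moments(1,3)[OF k] noise_moments(1)[OF l]
    by simp
qed

text \<open>The model asserts independence of the sigma-algebras generated by all noises and by all
  outputs. The first combination is measurable for the latter and the second for the former, so the
  smaller sigma-algebras that they generate inherit independence.\<close>

lemma signal_noise_indep:
  assumes K: "K \<subseteq> joint_idx q n"
  shows "indep_var borel (\<lambda>\<omega>. \<Sum>k\<in>K. c k * signal X xs k \<omega>) borel (\<lambda>\<omega>. \<Sum>k\<in>K. d k * noise k \<omega>)"
    (is "indep_var borel ?A borel ?B")
proof -
  let ?fv = "\<lambda>\<omega>. \<lambda>(i, x)\<in>outputs q \<times> UNIV. conv_output q gs gt Z i x \<omega>"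
  let ?nv = "\<lambda>\<omega>. \<lambda>k\<in>joint_idx q n. noise k \<omega>"
  let ?F = "vimage_algebra (space M) ?fv (PiM (outputs q \<times> UNIV) (\<lambda>_. borel))"
  let ?N = "vimage_algebra (space M) ?nv (PiM (joint_idx q n) (\<lambda>_. borel))"
  have ind: "indep_set (sets ?N) (sets ?F)"
    using noises_indep_outputs unfolding joint_idx_def noise_def .
  have NM: "sets ?N \<subseteq> events" and FM: "sets ?F \<subseteq> events"
    using ind by (auto simp: indep_sets2_eq)
  have fv: "?fv \<in> measurable ?F (PiM (outputs q \<times> UNIV) (\<lambda>_. borel))"
    by (rule measurable_vimage_algebra1) (auto simp: space_PiM)
  have nv: "?nv \<in> measurable ?N (PiM (joint_idx q n) (\<lambda>_. borel))"
    by (rule measurable_vimage_algebra1) (auto simp: space_PiM)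
  have A: "?A \<in> borel_measurable ?F"
  proof (intro borel_measurable_sum borel_measurable_times borel_measurable_const)
    fix k assume "k \<in> K"
    then have "joint_point X xs k \<in> outputs q \<times> UNIV"
      using joint_point_outputs K by (auto simp: mem_Times_iff)
    from measurable_compose[OF fv measurable_component_singleton[OF this]]
    show "signal X xs k \<in> borel_measurable ?F"
      using \<open>joint_point X xs k \<in> outputs q \<times> UNIV\<close> by (simp add: signal_def[abs_def] case_prod_beta)
  qed
  have B: "?B \<in> borel_measurable ?N"
  proof (intro borel_measurable_sum borel_measurable_times borel_measurable_const)
    fix k assume "k \<in> K"
    then have k: "k \<in> joint_idx q n" using K by auto
    from measurable_compose[OF nv measurable_component_singleton[OF this]]
    show "noise k \<in> borel_measurable ?N" using k by simp
  qed
  have sub: "sigma_sets (space M) {Y -` E \<inter> space M |E. E \<in> sets borel} \<subseteq> sets G"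
    if "Y \<in> borel_measurable G" "space G = space M" for Y :: "'a \<Rightarrow> real" and G
    using measurable_sets[OF that(1)] unfolding that(2)[symmetric]
    by (intro sets.sigma_sets_subset) auto
  have "random_variable borel ?A" "random_variable borel ?B"
    using subsetD[OF measurable_mono[OF order_refl refl FM] A] subsetD[OF measurable_mono[OF order_refl refl NM] B]
    by simp_all
  moreover have "indep_set (sigma_sets (space M) {?A -` E \<inter> space M |E. E \<in> sets borel})
      (sigma_sets (space M) {?B -` E \<inter> space M |E. E \<in> sets borel})" (is "indep_set ?SA ?SB")
    unfolding indep_sets2_eq
  proof (intro conjI ballI)
    have SA: "?SA \<subseteq> sets ?F" and SB: "?SB \<subseteq> sets ?N"
      using sub[OF A] sub[OF B] by simp_all
    show "?SA \<subseteq> events" "?SB \<subseteq> events"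
      using order_trans[OF SA FM] order_trans[OF SB NM] by simp_all
    fix a b assume "a \<in> ?SA" "b \<in> ?SB"
    then have "a \<in> sets ?F" "b \<in> sets ?N" using SA SB by blast+
    then have "prob (b \<inter> a) = prob b * prob a"
      using ind unfolding indep_sets2_eq by blast
    then show "prob (a \<inter> b) = prob a * prob b"
      by (simp only: Int_commute mult.commute)
  qed
  ultimately show ?thesis
    unfolding indep_var_eq by blast
qed

text \<open>Each combination is the sum of an output part and a noise part, both centred normal and
  independent of each other.\<close>

lemma gaussian_joint_obs: "centered_gaussian_family M (joint_idx q n) (joint_obs X xs)"
  unfolding centered_gaussian_family_def
proof (intro conjI ballI allI impI)
  fix k assume k: "k \<in> joint_idx q n"
  then show "joint_obs X xs k \<in> borel_measurable M"
    using noise_distr(1)[OF k] conv_output_moments(1)[OF joint_point_outputs[OF k]]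
    unfolding joint_obs_def[abs_def] signal_def by (intro borel_measurable_add)
next
  fix K c assume K: "finite K" "K \<subseteq> joint_idx q n"
  have "(\<Sum>k\<in>K. c k * joint_obs X xs k \<omega>) = (\<Sum>k\<in>K. c k * signal X xs k \<omega>) + (\<Sum>k\<in>K. c k * noise k \<omega>)" for \<omega>
    by (simp add: joint_obs_def distrib_left sum.distrib)
  moreover obtain v where v: "v \<ge> 0" "distr M borel (\<lambda>\<omega>. \<Sum>k\<in>K. c k * signal X xs k \<omega>) = normal_law 0 v"
    using distr_signal_sum[OF K(2)] by blast
  ultimately show "\<exists>v\<ge>0. distr M borel (\<lambda>\<omega>. \<Sum>k\<in>K. c k * joint_obs X xs k \<omega>) = normal_law 0 v"
    using distr_add_indep_normal[OF signal_noise_indep[OF K(2)] v sum_nonneg distr_noise_sum[OF K(2)]]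
    by (intro exI[of _ "v + (\<Sum>k\<in>K. (c k)\<^sup>2 * (joint_sd \<sigma> k)\<^sup>2)"]) (auto intro!: sum_nonneg add_nonneg_nonneg)
qed

section \<open>Second moments of the observations\<close>

lemma signal_second_moment:
  assumes k: "k \<in> joint_idx q n" and l: "l \<in> joint_idx q n"
  shows "expectation (\<lambda>\<omega>. signal X xs k \<omega> * signal X xs l \<omega>) =
    cov_f q gs gt (fst (joint_point X xs k)) (fst (joint_point X xs l))
      (snd (joint_point X xs k)) (snd (joint_point X xs l))"
  using covariance_conv_output[OF joint_point_outputs[OF k] joint_point_outputs[OF l],
      of X xs "snd (joint_point X xs k)" X xs "snd (joint_point X xs l)"]
  unfolding covariance_def expectation_conv_output[OF joint_point_outputs[OF k]]
    expectation_conv_output[OF joint_point_outputs[OF l]]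
  by (simp add: signal_def)

lemma signal_moments:
  assumes k: "k \<in> joint_idx q n"
  shows "signal X xs k \<in> borel_measurable M" "integrable M (\<lambda>\<omega>. (signal X xs k \<omega>)\<^sup>2)"
  using conv_output_moments[OF joint_point_outputs[OF k]] by (auto simp: signal_def)

lemma signal_noise_uncorrelated:
  assumes K: "K \<subseteq> joint_idx q n"
  shows "expectation (\<lambda>\<omega>. (\<Sum>k\<in>K. c k * signal X xs k \<omega>) * (\<Sum>k\<in>K. d k * noise k \<omega>)) = 0"
proof -
  have K': "k \<in> joint_idx q n" if "k \<in> K" for k using K that by auto
  have "integrable M (signal X xs k)" if "k \<in> K" for k
    using integrable_mult_of_squares[of "signal X xs k" "\<lambda>_. 1"] signal_moments[OF K'[OF that]] by simp
  moreover have "integrable M (noise k)" "expectation (noise k) = 0" if "k \<in> K" for k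
    using noise_moments(1,3)[OF K'[OF that]] by auto
  ultimately show ?thesis
    by (subst indep_var_lebesgue_integral[OF signal_noise_indep[OF K]]) auto
qed

lemma joint_obs_second_moment:
  assumes k: "k \<in> joint_idx q n" and l: "l \<in> joint_idx q n"
  shows "integrable M (\<lambda>\<omega>. joint_obs X xs k \<omega> * joint_obs X xs l \<omega>)"
    "expectation (\<lambda>\<omega>. joint_obs X xs k \<omega> * joint_obs X xs l \<omega>) = joint_cov (cov_f q gs gt) X xs \<sigma> k l"
proof -
  \<comment> \<open>Zero-one coefficients recover statements about single variables from those about
    combinations; this form also covers \<open>k = l\<close>.\<close>
  have pick: "(\<Sum>i\<in>{k, l}. (if i = a then 1 else 0) * f i) = f a" if "a \<in> {k, l}"
    for a and f :: "(label \<times> nat) option \<Rightarrow> real"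
    using that by (cases "k = l") auto
  have cross: "expectation (\<lambda>\<omega>. signal X xs a \<omega> * noise b \<omega>) = 0" if "a \<in> {k, l}" "b \<in> {k, l}" for a b
    using signal_noise_uncorrelated[of "{k, l}" "\<lambda>i. if i = a then 1 else 0" X xs "\<lambda>i. if i = b then 1 else 0"]
      that k l by (simp add: pick)
  note s = signal_moments[OF k, of X xs] signal_moments[OF l, of X xs]
    noise_distr(1)[OF k] noise_distr(1)[OF l] noise_moments(2)[OF k] noise_moments(2)[OF l]
  note i = integrable_mult_of_squares[OF s(1,3,2,4)] integrable_mult_of_squares[OF s(1,6,2,8)]
    integrable_mult_of_squares[OF s(3,5,4,7)] integrable_mult_of_squares[OF s(5,6,7,8)]
  have eq: "joint_obs X xs k \<omega> * joint_obs X xs l \<omega> =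
      ((signal X xs k \<omega> * signal X xs l \<omega> + signal X xs k \<omega> * noise l \<omega>) + signal X xs l \<omega> * noise k \<omega>) + noise k \<omega> * noise l \<omega>" for \<omega>
    by (simp add: joint_obs_def algebra_simps)
  show "integrable M (\<lambda>\<omega>. joint_obs X xs k \<omega> * joint_obs X xs l \<omega>)"
    unfolding eq using i by simp
  show "expectation (\<lambda>\<omega>. joint_obs X xs k \<omega> * joint_obs X xs l \<omega>) = joint_cov (cov_f q gs gt) X xs \<sigma> k l"
    unfolding eq using i cross signal_second_moment[OF k l] noise_second_moment[OF k l]
    by (simp add: joint_cov_def)
qed

text \<open>Read off from the commuting product of two observations, which avoids a substitution in
  the kernel integrals.\<close>

lemma joint_cov_sym:
  assumes "k \<in> joint_idx q n" "l \<in> joint_idx q n"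
  shows "joint_cov (cov_f q gs gt) X xs \<sigma> k l = joint_cov (cov_f q gs gt) X xs \<sigma> l k"
  using joint_obs_second_moment(2)[OF assms, of X xs] joint_obs_second_moment(2)[OF assms(2,1), of X xs]
  by (simp add: mult.commute)

lemma joint_obs_combo_second_moment:
  assumes K: "K \<subseteq> joint_idx q n"
  shows "expectation (\<lambda>\<omega>. (\<Sum>k\<in>K. c k * joint_obs X xs k \<omega>)\<^sup>2) =
    (\<Sum>k\<in>K. \<Sum>l\<in>K. c k * c l * joint_cov (cov_f q gs gt) X xs \<sigma> k l)"
proof -
  have "(\<Sum>k\<in>K. c k * joint_obs X xs k \<omega>)\<^sup>2 =
      (\<Sum>k\<in>K. \<Sum>l\<in>K. c k * c l * (joint_obs X xs k \<omega> * joint_obs X xs l \<omega>))" for \<omega>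
    by (simp add: power2_eq_square sum_product mult_ac)
  then show ?thesis
    using joint_obs_second_moment K by (simp add: subset_iff)
qed

text \<open>The output part and the noise part are uncorrelated, so their second moments add, and
  dropping the output part leaves the noise variance. This is the source of all strict positivity:
  of the covariance matrix and of the predictive variance.\<close>

lemma joint_obs_combo_lower_bound:
  assumes K: "K \<subseteq> joint_idx q n"
  shows "(\<Sum>k\<in>K. (c k)\<^sup>2 * (joint_sd \<sigma> k)\<^sup>2) \<le> expectation (\<lambda>\<omega>. (\<Sum>k\<in>K. c k * joint_obs X xs k \<omega>)\<^sup>2)"
proof -
  have fin: "finite K" using K finite_joint_idx by (rule finite_subset)
  let ?A = "\<lambda>\<omega>. \<Sum>k\<in>K. c k * signal X xs k \<omega>" and ?B = "\<lambda>\<omega>. \<Sum>k\<in>K. c k * noise k \<omega>"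
  have A [measurable]: "?A \<in> borel_measurable M" and B [measurable]: "?B \<in> borel_measurable M"
    using signal_noise_indep[OF K, of c X xs c] by (auto dest: indep_var_rv1 indep_var_rv2)
  obtain v where v: "v \<ge> 0" "distr M borel ?A = normal_law 0 v"
    using distr_signal_sum[OF K] by blast
  note mA = normal_distr_moments[OF A v] and mB = normal_distr_moments[OF B _ distr_noise_sum[OF K]]
  have pos: "0 \<le> (\<Sum>k\<in>K. (c k)\<^sup>2 * (joint_sd \<sigma> k)\<^sup>2)" by (auto intro: sum_nonneg)
  have eq: "(\<Sum>k\<in>K. c k * joint_obs X xs k \<omega>)\<^sup>2 = ((?A \<omega>)\<^sup>2 + (?B \<omega>)\<^sup>2) + 2 * (?A \<omega> * ?B \<omega>)" for \<omega>
    by (simp add: joint_obs_def distrib_left sum.distrib power2_sum)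
  have "expectation (\<lambda>\<omega>. (\<Sum>k\<in>K. c k * joint_obs X xs k \<omega>)\<^sup>2) = v + (\<Sum>k\<in>K. (c k)\<^sup>2 * (joint_sd \<sigma> k)\<^sup>2)"
    unfolding eq using mA(2,4) mB(2,4)[OF pos] integrable_mult_of_squares[OF A B mA(2) mB(2)[OF pos]]
      signal_noise_uncorrelated[OF K, of c X xs c] by simp
  then show ?thesis using v by simp
qed

end

section \<open>The matrices as joint covariances\<close>

text \<open>Flattens the blocks in the order in which \<open>concat_vec\<close> and the block
  matrices arrange them, so that position \<open>r\<close> of a vector or matrix belongs to the
  observation \<open>idx_list n is ! r\<close>.\<close>

definition idx_list :: "(label \<Rightarrow> nat) \<Rightarrow> label list \<Rightarrow> (label \<times> nat) list" where
  "idx_list n is = concat (map (\<lambda>i. map (Pair i) [0..<n i]) is)"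

lemma idx_list_simps [simp]:
  "idx_list n [] = []"
  "idx_list n (i # is) = map (Pair i) [0..<n i] @ idx_list n is"
  "idx_list n (is @ js) = idx_list n is @ idx_list n js"
  unfolding idx_list_def by simp_all

lemma set_idx_list: "set (idx_list n is) = obs_idx (set is) n"
  by (auto simp: idx_list_def obs_idx_def)

lemma distinct_idx_list: "distinct is \<Longrightarrow> distinct (idx_list n is)"
  by (induction "is") (auto simp: distinct_map inj_on_def set_idx_list obs_idx_def)

lemma C_mat_eq_joint_cov:
  "C_mat c n X \<sigma> i j = mat (n i) (n j) (\<lambda>(a, b). joint_cov c X xs \<sigma> (Some (i, a)) (Some (j, b)))"
  by (intro eq_matI) (auto simp: C_mat_def joint_cov_def)

text \<open>The zero blocks are genuine covariances: different labels make \<open>c\<close> vanish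
  by assumption, and they also exclude the noise term of \<open>joint_cov\<close>.\<close>

lemma diag_block_mat_C_mat:
  fixes n :: "label \<Rightarrow> nat" and "is" :: "label list"
  assumes "distinct is" and "\<And>i j x x'. i \<in> set is \<Longrightarrow> j \<in> set is \<Longrightarrow> i \<noteq> j \<Longrightarrow> c i j x x' = 0"
  defines "L \<equiv> idx_list n is"
  shows "diag_block_mat (map (\<lambda>i. C_mat c n X \<sigma> i i) is) =
    mat (length L) (length L) (\<lambda>(r, s). joint_cov c X xs \<sigma> (Some (L ! r)) (Some (L ! s)))"
  using assms(1,2) unfolding L_def
proof (induction "is")
  case Nil
  then show ?case by (intro eq_matI) auto
next
  case (Cons i "is")
  let ?L = "idx_list n is"
  have IH: "diag_block_mat (map (\<lambda>i. C_mat c n X \<sigma> i i) is) =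
      mat (length ?L) (length ?L) (\<lambda>(r, s). joint_cov c X xs \<sigma> (Some (?L ! r)) (Some (?L ! s)))"
    using Cons.prems by (intro Cons.IH) auto
  have mem: "fst (?L ! r) \<in> set is" if "r < length ?L" for r
    using nth_mem[OF that] by (auto simp: set_idx_list obs_idx_def)
  have zero: "joint_cov c X xs \<sigma> (Some (i, a)) (Some (?L ! r)) = 0" "joint_cov c X xs \<sigma> (Some (?L ! r)) (Some (i, a)) = 0"
    if "r < length ?L" for r a
    using mem[OF that] Cons.prems by (cases "?L ! r"; auto simp: joint_cov_def)+
  have dim: "dim_row (C_mat c n X \<sigma> i i) = n i" "dim_col (C_mat c n X \<sigma> i i) = n i"
    by (simp_all add: C_mat_def)
  show ?case
  proof (rule eq_matI)
    fix r s
    assume "r < dim_row (mat (length (idx_list n (i # is))) (length (idx_list n (i # is)))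
        (\<lambda>(r, s). joint_cov c X xs \<sigma> (Some (idx_list n (i # is) ! r)) (Some (idx_list n (i # is) ! s))))"
      and "s < dim_col (mat (length (idx_list n (i # is))) (length (idx_list n (i # is)))
        (\<lambda>(r, s). joint_cov c X xs \<sigma> (Some (idx_list n (i # is) ! r)) (Some (idx_list n (i # is) ! s))))"
    then have r: "r < n i + length ?L" and s: "s < n i + length ?L" by auto
    have B: "diag_block_mat (map (\<lambda>i. C_mat c n X \<sigma> i i) (i # is)) $$ (r, s) =
      (if r < n i then if s < n i then C_mat c n X \<sigma> i i $$ (r, s) else 0
       else if s < n i then 0 else joint_cov c X xs \<sigma> (Some (?L ! (r - n i))) (Some (?L ! (s - n i))))"
      using r s by (simp add: Let_def IH dim)
    show "diag_block_mat (map (\<lambda>i. C_mat c n X \<sigma> i i) (i # is)) $$ (r, s) =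
      mat (length (idx_list n (i # is))) (length (idx_list n (i # is)))
        (\<lambda>(r, s). joint_cov c X xs \<sigma> (Some (idx_list n (i # is) ! r)) (Some (idx_list n (i # is) ! s))) $$ (r, s)"
      unfolding B using r s by (auto simp: nth_append C_mat_eq_joint_cov[where xs = xs] zero)
  qed (simp_all add: Let_def IH dim)
qed

lemma concat_rows_C_mat:
  "concat (map (\<lambda>i. rows (C_mat c n X \<sigma> i j)) is) =
   map (\<lambda>p. vec (n j) (\<lambda>b. joint_cov c X xs \<sigma> (Some p) (Some (j, b)))) (idx_list n is)"
proof (induction "is")
  case (Cons i "is")
  have "rows (C_mat c n X \<sigma> i j) =
      map (\<lambda>a. vec (n j) (\<lambda>b. joint_cov c X xs \<sigma> (Some (i, a)) (Some (j, b)))) [0..<n i]"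
    by (intro nth_equalityI) (auto simp: rows_def C_mat_eq_joint_cov[where xs = xs])
  with Cons.IH show ?case by (simp add: comp_def)
qed simp

text \<open>Identifies the displayed block matrix with the covariance matrix of the retained
  observations. Vanishing between different sources accounts for the diagonal part, and symmetry of
  \<open>c\<close> for the transposed lower left block.\<close>

lemma C_plus_eq_joint_cov:
  fixes n :: "label \<Rightarrow> nat" and h q :: nat
  assumes src: "\<And>i j x x'. i \<noteq> j \<Longrightarrow> c (Src i) (Src j) x x' = 0"
    and sym: "\<And>i x x'. c Tgt (Src i) x x' = c (Src i) Tgt x' x"
  defines "L \<equiv> idx_list n (idx_plus h q)"
  shows "C_plus h q c n X \<sigma> =
    mat (length L) (length L) (\<lambda>(r, s). joint_cov c X xs \<sigma> (Some (L ! r)) (Some (L ! s)))"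
proof -
  let ?L = "idx_list n (src_plus h q)"
  have L: "L = ?L @ map (Pair Tgt) [0..<n Tgt]"
    by (simp add: L_def idx_plus_def)
  have S: "diag_block_mat (map (\<lambda>i. C_mat c n X \<sigma> i i) (src_plus h q)) =
      mat (length ?L) (length ?L) (\<lambda>(r, s). joint_cov c X xs \<sigma> (Some (?L ! r)) (Some (?L ! s)))"
  proof (rule diag_block_mat_C_mat)
    show "distinct (src_plus h q)"
      by (auto simp: src_plus_def distinct_map inj_on_def)
    show "c i j x x' = 0" if "i \<in> set (src_plus h q)" "j \<in> set (src_plus h q)" "i \<noteq> j" for i j x x'
      using that by (auto simp: src_plus_def intro: src)
  qed
  have cov_sym: "joint_cov c X xs \<sigma> (Some (?L ! r)) (Some (Tgt, b)) = joint_cov c X xs \<sigma> (Some (Tgt, b)) (Some (?L ! r))"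
    if "r < length ?L" for r b
    using nth_mem[OF that] by (auto simp: set_idx_list obs_idx_def src_plus_def joint_cov_def sym)
  show ?thesis
    unfolding C_plus_def Let_def S concat_rows_C_mat[where xs = xs]
    unfolding C_mat_eq_joint_cov[where xs = xs]
    by (intro eq_matI)
      (auto simp: L nth_append mat_of_rows_def intro: cov_sym)
qed

section \<open>Concatenated vectors and inverses of positive definite matrices\<close>

lemma concat_vec_blocks:
  "concat_vec (map (\<lambda>i. vec (n i) (f i)) is) =
   vec (length (idx_list n is)) (\<lambda>r. case_prod f (idx_list n is ! r))"
proof -
  have "concat (map list_of_vec (map (\<lambda>i. vec (n i) (f i)) is)) = map (case_prod f) (idx_list n is)"
    by (induction "is") (auto simp: comp_def)
  then show ?thesis
    by (intro eq_vecI) (auto simp: concat_vec_def index_vec_of_list simp del: vec_of_list_map)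
qed

text \<open>No noise variance enters because \<open>None\<close> differs from every
  \<open>Some\<close> index: the noise of the new observation is fresh.\<close>

lemma k_plus_eq_joint_cov:
  fixes n :: "label \<Rightarrow> nat" and h q :: nat
  defines "L \<equiv> idx_list n (idx_plus h q)"
  shows "k_plus h q c n X xs = vec (length L) (\<lambda>r. joint_cov c X xs \<sigma> (Some (L ! r)) None)"
  unfolding k_plus_def K_vec_def concat_vec_blocks L_def
  by (intro eq_vecI) (auto simp: joint_cov_def split: prod.split)

lemma y_plus_eq:
  fixes n :: "label \<Rightarrow> nat" and h q :: nat
  defines "L \<equiv> idx_list n (idx_plus h q)"
  shows "y_plus h q n z = vec (length L) (\<lambda>r. z (L ! r))"
  unfolding y_plus_def concat_vec_blocks L_def by (intro eq_vecI) (auto split: prod.split)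

text \<open>A nonzero vector in the kernel of \<open>C\<close> would violate positivity, so the
  determinant is nonzero. Hence \<open>mat_inverse\<close> succeeds and the \<open>the\<close> in
  \<open>inv_mat\<close> denotes the actual inverse.\<close>

lemma inv_mat_of_pos_def:
  fixes C :: "real mat"
  assumes C: "C \<in> carrier_mat N N"
    and pos: "\<And>x. x \<in> carrier_vec N \<Longrightarrow> x \<noteq> 0\<^sub>v N \<Longrightarrow> x \<bullet> (C *\<^sub>v x) > 0"
  shows "C * inv_mat C = 1\<^sub>m N" "inv_mat C * C = 1\<^sub>m N" "inv_mat C \<in> carrier_mat N N" "invertible_mat C"
proof -
  have "Determinant.det C \<noteq> 0"
    unfolding det_0_iff_vec_prod_zero_field[OF C] using pos by fastforce
  then have "C \<in> Units (ring_mat TYPE(real) N ())"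
    by (rule det_non_zero_imp_unit[OF C])
  then obtain D where "mat_inverse C = Some D"
    using mat_inverse(1)[OF C, of "()"] by (cases "mat_inverse C") auto
  then show *: "C * inv_mat C = 1\<^sub>m N" "inv_mat C * C = 1\<^sub>m N" "inv_mat C \<in> carrier_mat N N"
    using mat_inverse(2)[OF C] by (simp_all add: inv_mat_def)
  then show "invertible_mat C"
    using C unfolding invertible_mat_def inverts_mat_def by (auto intro!: exI[of _ "inv_mat C"])
qed

text \<open>Writing \<open>k\<close> as \<open>C\<close> applied to
  \<open>inv_mat C *\<^sub>v k\<close> and moving the symmetric \<open>C\<close> across the product
  avoids proving that the inverse is symmetric. It turns the predictive mean into a fixed weight
  vector applied to the data.\<close>

lemma scalar_prod_inv_mat_swap:
  fixes C :: "real mat"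
  assumes C: "C \<in> carrier_mat N N" and sym: "transpose_mat C = C"
    and inv: "C * inv_mat C = 1\<^sub>m N" "inv_mat C \<in> carrier_mat N N"
    and k: "k \<in> carrier_vec N" and y: "y \<in> carrier_vec N"
  shows "k \<bullet> (inv_mat C *\<^sub>v y) = (inv_mat C *\<^sub>v k) \<bullet> y"
proof -
  have solve: "C *\<^sub>v (inv_mat C *\<^sub>v v) = v" if "v \<in> carrier_vec N" for v
    using assoc_mult_mat_vec[OF C inv(2) that] inv(1) that by simp
  have "k \<bullet> (inv_mat C *\<^sub>v y) = (transpose_mat C *\<^sub>v (inv_mat C *\<^sub>v k)) \<bullet> (inv_mat C *\<^sub>v y)"
    by (simp only: sym solve[OF k])
  also have "\<dots> = (inv_mat C *\<^sub>v k) \<bullet> (C *\<^sub>v (inv_mat C *\<^sub>v y))"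
    using C inv(2) k y by (intro transpose_vec_mult_scalar) auto
  finally show ?thesis by (simp only: solve[OF y])
qed

text \<open>Converts a vector over the positions of \<open>L\<close> into a function on observations
  that is zero off \<open>L\<close>. The weights of the retained data thereby become weights on any
  larger set of observations.\<close>

definition idx_coef :: "'b list \<Rightarrow> real vec \<Rightarrow> 'b \<Rightarrow> real" where
  "idx_coef L x p = (\<Sum>r<length L. if L ! r = p then x $ r else 0)"

lemma idx_coef_nth:
  assumes "distinct L" "r < length L"
  shows "idx_coef L x (L ! r) = x $ r"
proof -
  have "idx_coef L x (L ! r) = (\<Sum>s<length L. if s = r then x $ s else 0)"
    unfolding idx_coef_def using assms by (intro sum.cong) (auto simp: nth_eq_iff_index_eq)
  then show ?thesis using assms by simp
qed

lemma sum_idx_coef: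
  assumes "finite J" "set L \<subseteq> J"
  shows "(\<Sum>p\<in>J. idx_coef L x p * g p) = (\<Sum>r<length L. x $ r * g (L ! r))"
proof -
  have "(\<Sum>p\<in>J. idx_coef L x p * g p) = (\<Sum>r<length L. \<Sum>p\<in>J. if L ! r = p then x $ r * g p else 0)"
    unfolding idx_coef_def sum_distrib_right
    by (subst sum.swap) (intro sum.cong refl, auto)
  also have "\<dots> = (\<Sum>r<length L. x $ r * g (L ! r))"
  proof (intro sum.cong refl)
    fix r assume "r \<in> {..<length L}"
    then have "L ! r \<in> J" using assms(2) by auto
    then show "(\<Sum>p\<in>J. if L ! r = p then x $ r * g p else 0) = x $ r * g (L ! r)"
      using assms(1) by (simp add: sum.delta')
  qed
  finally show ?thesis .
qed

section \<open>Dependence of the prediction on the retained labels only\<close>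

lemma set_idx_plus: "set (idx_plus h q) = Src ` {h+1..q} \<union> {Tgt}"
  by (auto simp: idx_plus_def src_plus_def)

lemma distinct_idx_plus: "distinct (idx_plus h q)"
  by (auto simp: idx_plus_def src_plus_def distinct_map inj_on_def)

lemma C_mat_cong:
  assumes "\<And>x x'. c' i j x x' = c i j x x'" "n' i = n i" "n' j = n j" "\<sigma>' i = \<sigma> i"
    "\<And>a. a < n i \<Longrightarrow> X' i a = X i a" "\<And>a. a < n j \<Longrightarrow> X' j a = X j a"
  shows "C_mat c' n' X' \<sigma>' i j = C_mat c n X \<sigma> i j"
  using assms by (intro eq_matI) (auto simp: C_mat_def)

text \<open>All blocks of the matrix and of both vectors carry labels from
  \<open>idx_plus h q\<close>, so agreement on these labels fixes the prediction. This expresses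
  that kernels, points and values of the discarded sources do not enter the formula.\<close>

lemma prediction_cong:
  assumes c: "\<And>i j x x'. i \<in> set (idx_plus h q) \<Longrightarrow> j \<in> set (idx_plus h q) \<Longrightarrow> c' i j x x' = c i j x x'"
    and eq: "\<And>i. i \<in> set (idx_plus h q) \<Longrightarrow> n' i = n i" "\<And>i. i \<in> set (idx_plus h q) \<Longrightarrow> \<sigma>' i = \<sigma> i"
    "\<And>i a. i \<in> set (idx_plus h q) \<Longrightarrow> a < n i \<Longrightarrow> X' i a = X i a"
    "\<And>i a. i \<in> set (idx_plus h q) \<Longrightarrow> a < n i \<Longrightarrow> z' (i, a) = z (i, a)"
  shows "pred_mean h q c' n' X' \<sigma>' xs z' = pred_mean h q c n X \<sigma> xs z"
    "pred_var h q c' n' X' \<sigma>' xs = pred_var h q c n X \<sigma> xs"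
proof -
  have Tgt: "Tgt \<in> set (idx_plus h q)" and src: "set (src_plus h q) \<subseteq> set (idx_plus h q)"
    by (auto simp: idx_plus_def)
  have CC: "C_mat c' n' X' \<sigma>' i j = C_mat c n X \<sigma> i j" if "i \<in> set (idx_plus h q)" "j \<in> set (idx_plus h q)" for i j
    using that c eq by (intro C_mat_cong) auto
  have C: "C_plus h q c' n' X' \<sigma>' = C_plus h q c n X \<sigma>"
    unfolding C_plus_def using CC Tgt src eq(1)[OF Tgt] by (simp add: subset_iff cong: map_cong)
  have k: "k_plus h q c' n' X' xs = k_plus h q c n X xs"
    unfolding k_plus_def
    by (intro arg_cong[of _ _ concat_vec] map_cong refl eq_vecI) (use Tgt c eq in \<open>auto simp: K_vec_def\<close>)
  have y: "y_plus h q n' z' = y_plus h q n z"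
    unfolding y_plus_def
    by (intro arg_cong[of _ _ concat_vec] map_cong refl eq_vecI) (use eq in auto)
  show "pred_mean h q c' n' X' \<sigma>' xs z' = pred_mean h q c n X \<sigma> xs z"
    unfolding pred_mean_def C k y ..
  show "pred_var h q c' n' X' \<sigma>' xs = pred_var h q c n X \<sigma> xs"
    unfolding pred_var_def C k using Tgt c eq by simp
qed

section \<open>The predictive distribution\<close>

context noisy_convolution_process
begin

lemma obs_idx_plus_subset: "obs_idx (set (idx_plus h q)) n \<subseteq> obs_idx (outputs q) n"
  by (auto simp: obs_idx_def set_idx_plus)

lemma Some_obs_idx_subset: "J \<subseteq> obs_idx (outputs q) n \<Longrightarrow> Some ` J \<subseteq> joint_idx q n"
  by (auto simp: joint_idx_def)

text \<open>The quadratic form is the second moment of a combination of retained observations, and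
  the noise part alone keeps it positive.\<close>

lemma C_plus_pos_def:
  assumes x: "x \<in> carrier_vec (length (idx_list n (idx_plus h q)))" "x \<noteq> 0\<^sub>v (length (idx_list n (idx_plus h q)))"
  shows "x \<bullet> (C_plus h q (cov_f q gs gt) n X \<sigma> *\<^sub>v x) > 0"
proof -
  \<comment> \<open>An arbitrary choice: on \<open>Some\<close> indices \<open>joint_cov\<close>
    never evaluates the new input point.\<close>
  define xs :: "real^'d" where "xs = 0"
  let ?c = "cov_f q gs gt"
  let ?L = "idx_list n (idx_plus h q)"
  let ?S = "map Some ?L"
  let ?K = "set ?S"
  let ?N = "length ?L"
  have K: "?K \<subseteq> joint_idx q n"
    using Some_obs_idx_subset[OF obs_idx_plus_subset] by (simp add: set_idx_list)
  have dist: "distinct ?S"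
    using distinct_idx_list[OF distinct_idx_plus] by (simp add: distinct_map)
  have C_eq: "C_plus h q ?c n X \<sigma> =
      mat ?N ?N (\<lambda>(r, s). joint_cov ?c X xs \<sigma> (Some (?L ! r)) (Some (?L ! s)))"
    by (rule C_plus_eq_joint_cov) simp_all
  have "x \<bullet> (C_plus h q ?c n X \<sigma> *\<^sub>v x) =
      (\<Sum>r<?N. \<Sum>s<?N. x $ r * x $ s * joint_cov ?c X xs \<sigma> (?S ! r) (?S ! s))"
    using x(1) unfolding C_eq
    by (simp add: scalar_prod_def sum_distrib_left mult_ac atLeast0LessThan)
  also have "\<dots> = (\<Sum>k\<in>?K. \<Sum>l\<in>?K. idx_coef ?S x k * idx_coef ?S x l * joint_cov ?c X xs \<sigma> k l)"
    by (simp only: mult.assoc sum_distrib_left[symmetric] sum_idx_coef[OF finite_set order_refl] length_map)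
  also have "\<dots> = expectation (\<lambda>\<omega>. (\<Sum>k\<in>?K. idx_coef ?S x k * joint_obs X xs k \<omega>)\<^sup>2)"
    by (rule joint_obs_combo_second_moment[OF K, symmetric])
  also have "\<dots> \<ge> (\<Sum>k\<in>?K. (idx_coef ?S x k)\<^sup>2 * (joint_sd \<sigma> k)\<^sup>2)"
    by (rule joint_obs_combo_lower_bound[OF K])
  finally have le: "(\<Sum>k\<in>?K. (idx_coef ?S x k)\<^sup>2 * (joint_sd \<sigma> k)\<^sup>2) \<le> x \<bullet> (C_plus h q ?c n X \<sigma> *\<^sub>v x)" .
  obtain r where r: "r < ?N" "x $ r \<noteq> 0"
    using x by (metis carrier_vecD eq_vecI index_zero_vec)
  have S_r: "?S ! r \<in> ?K" by (rule nth_mem) (simp add: r(1))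
  \<comment> \<open>The list is distinct, so the nonzero entry \<open>x $ r\<close> is not merged
    with (and cancelled by) another one.\<close>
  moreover have "idx_coef ?S x (?S ! r) \<noteq> 0"
    using idx_coef_nth[OF dist, of r x] r by simp
  moreover have "0 < joint_sd \<sigma> (?S ! r)"
    by (rule joint_sd_pos[OF subsetD[OF K S_r]])
  ultimately have "0 < (\<Sum>k\<in>?K. (idx_coef ?S x k)\<^sup>2 * (joint_sd \<sigma> k)\<^sup>2)"
    by (intro sum_pos2[of _ "?S ! r"]) (simp_all only: finite_set zero_less_mult_iff zero_less_power2, auto)
  with le show ?thesis by simp
qed

text \<open>The freedom in \<open>J\<close> carries the independence claim: conditioning on
  additional observations of discarded sources leaves the kernel unchanged.\<close>

theorem conditional_target_distribution:
  assumes zero: "\<And>i x. i \<in> {1..h} \<Longrightarrow> gt (Src i) x = 0"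
    and J: "obs_idx (set (idx_plus h q)) n \<subseteq> J" "J \<subseteq> obs_idx (outputs q) n"
  shows "is_cond_distr M (PiM J (\<lambda>_. borel)) (obs (conv_output q gs gt Z) X eps J)
      (\<lambda>\<omega>. conv_output q gs gt Z Tgt xs \<omega> + eps_new \<omega>)
      (\<lambda>z. normal_law (pred_mean h q (cov_f q gs gt) n X \<sigma> xs z) (pred_var h q (cov_f q gs gt) n X \<sigma> xs))"
    "pred_var h q (cov_f q gs gt) n X \<sigma> xs > 0"
proof -
  let ?c = "cov_f q gs gt"
  let ?cov = "joint_cov ?c X xs \<sigma>"
  define L where "L = idx_list n (idx_plus h q)"
  define N where "N = length L"
  define C where "C = C_plus h q ?c n X \<sigma>"
  define k where "k = k_plus h q ?c n X xs"
  define w where "w = inv_mat C *\<^sub>v k"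
  \<comment> \<open>The regression weights on \<open>J\<close>: entries of \<open>w\<close> at
    retained observations, zero at discarded ones.\<close>
  define co where "co = idx_coef L w"
  have L_J: "set L \<subseteq> J" using J(1) by (simp add: L_def set_idx_list)
  have fin: "finite J" using J(2) finite_obs_idx by (rule finite_subset)
  have C_eq: "C = mat N N (\<lambda>(r, s). ?cov (Some (L ! r)) (Some (L ! s)))"
    unfolding C_def N_def L_def by (rule C_plus_eq_joint_cov) simp_all
  have k_eq: "k = vec N (\<lambda>r. ?cov (Some (L ! r)) None)"
    unfolding k_def N_def L_def by (rule k_plus_eq_joint_cov)
  have C: "C \<in> carrier_mat N N" and k: "k \<in> carrier_vec N" by (simp_all add: C_eq k_eq)
  have idx: "None \<in> joint_idx q n" "\<And>p. p \<in> J \<Longrightarrow> Some p \<in> joint_idx q n"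
    using J(2) by (auto simp: joint_idx_def)
  have idx_L: "Some (L ! r) \<in> joint_idx q n" if "r < N" for r
    using L_J that by (intro idx(2)) (auto simp: N_def)
  note cov_sym = joint_cov_sym[of _ _ X xs]
  have C_sym: "transpose_mat C = C"
    unfolding C_eq by (intro eq_matI) (auto intro: cov_sym idx_L)
  have pos: "x \<bullet> (C *\<^sub>v x) > 0" if "x \<in> carrier_vec N" "x \<noteq> 0\<^sub>v N" for x
    using C_plus_pos_def that by (simp add: C_def N_def L_def)
  note inv = inv_mat_of_pos_def[OF C pos]
  have w: "w \<in> carrier_vec N" using inv(3) k by (simp add: w_def)
  have Cw: "C *\<^sub>v w = k"
    using assoc_mult_mat_vec[OF C inv(3) k] inv(1) k by (simp add: w_def)
  have swap: "k \<bullet> (inv_mat C *\<^sub>v y) = (\<Sum>r<N. w $ r * y $ r)" if "y \<in> carrier_vec N" for y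
    using scalar_prod_inv_mat_swap[OF C C_sym inv(1,3) k that] that
    by (simp add: w_def scalar_prod_def atLeast0LessThan)
  have sum_co: "(\<Sum>p\<in>J. co p * g p) = (\<Sum>r<N. w $ r * g (L ! r))" for g
    unfolding co_def N_def by (rule sum_idx_coef[OF fin L_J])
  have mean: "pred_mean h q ?c n X \<sigma> xs z = (\<Sum>p\<in>J. co p * z p)" for z
    unfolding pred_mean_def sum_co k_def[symmetric] C_def[symmetric]
    by (subst swap) (auto simp: y_plus_eq N_def L_def)
  have var: "pred_var h q ?c n X \<sigma> xs = ?cov None None - (\<Sum>p\<in>J. co p * ?cov (Some p) None)"
    unfolding pred_var_def sum_co k_def[symmetric] C_def[symmetric] swap[OF k]
    by (simp add: joint_cov_def k_eq)
  \<comment> \<open>A discarded source shares with the target only its own white noise, which enters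
    the target through the zero kernel \<open>gt (Src i)\<close>; with the retained sources it
    shares none.\<close>
  have cov_zero: "?cov k l = 0" if "k = Some (Src i, a)" "i \<in> {1..h}" "l = None \<or> (\<exists>p\<in>set L. l = Some p)" for k l i a
  proof -
    have "kernel_corr (gs i) (gt (Src i)) v = 0" for v
      using zero that(2) by (simp add: kernel_corr_def)
    then show ?thesis
      using that by (auto simp: joint_cov_def L_def set_idx_list obs_idx_def set_idx_plus)
  qed
  \<comment> \<open>Orthogonality of the residual to the observation \<open>b\<close>. For retained
    \<open>b\<close> this is a row of \<open>C *\<^sub>v w = k\<close>; for discarded
    \<open>b\<close> every covariance involved is zero.\<close>
  have normal_eq: "?cov None (Some b) - (\<Sum>p\<in>J. co p * ?cov (Some p) (Some b)) = 0" if b: "b \<in> J" for b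
  proof (cases "b \<in> set L")
    case True
    then obtain s where s: "s < N" "b = L ! s" by (auto simp: in_set_conv_nth N_def)
    have "(\<Sum>p\<in>J. co p * ?cov (Some p) (Some b)) = (\<Sum>r<N. ?cov (Some b) (Some (L ! r)) * w $ r)"
      unfolding sum_co using s idx_L by (intro sum.cong) (auto simp: cov_sym mult.commute)
    also have "\<dots> = (C *\<^sub>v w) $ s"
      using s C w by (simp add: scalar_prod_def atLeast0LessThan C_eq)
    finally show ?thesis
      using s idx idx_L by (simp add: Cw k_eq cov_sym[of None])
  next
    case False
    obtain l a where la: "b = (l, a)" by (cases b)
    then have "(l, a) \<in> obs_idx (outputs q) n" "(l, a) \<notin> obs_idx (set (idx_plus h q)) n"
      using False b J(2) by (auto simp: L_def set_idx_list)
    then have "l \<in> outputs q" "l \<notin> set (idx_plus h q)"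
      by (auto simp: obs_idx_def)
    \<comment> \<open>The target is always retained, so a label outside \<open>idx_plus h q\<close>
      is a source of number at most \<open>h\<close>.\<close>
    then obtain i where "l = Src i" "i \<in> {1..h}"
      by (cases l) (auto simp: set_idx_plus image_iff not_le Suc_le_eq)
    with la have i: "b = (Src i, a)" "i \<in> {1..h}" by simp_all
    have "?cov (Some (L ! r)) (Some b) = 0" if "r < N" for r
      unfolding cov_sym[OF idx_L[OF that] idx(2)[OF b]]
      using i that by (intro cov_zero) (auto simp: N_def)
    moreover have "?cov None (Some b) = 0"
      unfolding cov_sym[OF idx(1) idx(2)[OF b]] using i by (intro cov_zero) auto
    ultimately show ?thesis unfolding sum_co by simp
  qed
  let ?U = "\<lambda>p. joint_obs X xs (Some p)"
  let ?Y = "joint_obs X xs None"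
  let ?R = "\<lambda>\<omega>. ?Y \<omega> - (\<Sum>p\<in>J. co p * ?U p \<omega>)"
  have R_cov: "expectation (\<lambda>\<omega>. ?R \<omega> * joint_obs X xs l \<omega>) = ?cov None l - (\<Sum>p\<in>J. co p * ?cov (Some p) l)"
    if l: "l \<in> joint_idx q n" for l
  proof -
    have "expectation (\<lambda>\<omega>. ?R \<omega> * joint_obs X xs l \<omega>) =
        expectation (\<lambda>\<omega>. ?Y \<omega> * joint_obs X xs l \<omega> - (\<Sum>p\<in>J. co p * (?U p \<omega> * joint_obs X xs l \<omega>)))"
      by (simp add: left_diff_distrib sum_distrib_right mult.assoc)
    also have "\<dots> = ?cov None l - (\<Sum>p\<in>J. co p * ?cov (Some p) l)"
      using joint_obs_second_moment idx l by simp
    finally show ?thesis .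
  qed
  have orth: "expectation (\<lambda>\<omega>. ?R \<omega> * ?U b \<omega>) = 0" if "b \<in> J" for b
    using R_cov[OF idx(2)[OF that]] normal_eq[OF that] by simp
  have sum_factor: "(\<Sum>p\<in>J. co p * (a * ?U p \<omega>)) = a * (\<Sum>p\<in>J. co p * ?U p \<omega>)" for a \<omega>
    by (simp add: sum_distrib_left mult.left_commute)
  \<comment> \<open>Only one factor is expanded: the products of \<open>?R\<close> with the data
    have mean zero, which leaves the mean of \<open>?R\<close> times \<open>?Y\<close>.\<close>
  have R_sq: "(?R \<omega>)\<^sup>2 = ?R \<omega> * ?Y \<omega> - (\<Sum>p\<in>J. co p * (?R \<omega> * ?U p \<omega>))" for \<omega>
    by (simp only: sum_factor power2_eq_square right_diff_distrib)
  have int: "integrable M (\<lambda>\<omega>. ?R \<omega> * joint_obs X xs l \<omega>)" if "l \<in> joint_idx q n" for l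
    using joint_obs_second_moment(1) idx that
    by (simp add: left_diff_distrib sum_distrib_right mult.assoc)
  have "expectation (\<lambda>\<omega>. (?R \<omega>)\<^sup>2) = expectation (\<lambda>\<omega>. ?R \<omega> * ?Y \<omega>)"
    unfolding R_sq using int idx orth by simp
  then have R_var: "expectation (\<lambda>\<omega>. (?R \<omega>)\<^sup>2) = pred_var h q ?c n X \<sigma> xs"
    using R_cov[OF idx(1)] var by simp
  \<comment> \<open>\<open>case_option\<close> merges the coefficient of the new observation and
    those of the data into one family over the joint index set.\<close>
  have combo: "(\<Sum>l\<in>insert None (Some ` J). case_option r t l * joint_obs X xs l \<omega>) =
      r * ?Y \<omega> + (\<Sum>p\<in>J. t p * ?U p \<omega>)" for r t \<omega>
    using fin by (subst sum.insert) (auto simp: sum.reindex)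
  have K: "insert None (Some ` J) \<subseteq> joint_idx q n" using idx by auto
  have meas: "joint_obs X xs l \<in> borel_measurable M" if "l \<in> joint_idx q n" for l
    using gaussian_joint_obs that by (auto simp: centered_gaussian_family_def)
  have "is_cond_distr M (PiM J (\<lambda>_. borel)) (\<lambda>\<omega>. \<lambda>p\<in>J. ?U p \<omega>) ?Y
      (\<lambda>z. normal_law (\<Sum>p\<in>J. co p * z p) (expectation (\<lambda>\<omega>. (?R \<omega>)\<^sup>2)))"
  proof (rule gaussian_regression[OF fin _ _ _ orth])
    fix r t
    show "\<exists>v\<ge>0. distr M borel (\<lambda>\<omega>. r * ?Y \<omega> + (\<Sum>p\<in>J. t p * ?U p \<omega>)) = normal_law 0 v"
      unfolding combo[symmetric]
      by (rule gaussian_joint_obs[unfolded centered_gaussian_family_def, THEN conjunct2, rule_format,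
            OF finite_subset[OF K finite_joint_idx] K])
  qed (use meas idx in auto)
  moreover have "(\<lambda>\<omega>. \<lambda>p\<in>J. ?U p \<omega>) = obs (conv_output q gs gt Z) X eps J"
    by (auto simp: obs_def joint_obs_def signal_def noise_def fun_eq_iff restrict_def)
  moreover have "?Y = (\<lambda>\<omega>. conv_output q gs gt Z Tgt xs \<omega> + eps_new \<omega>)"
    by (auto simp: joint_obs_def signal_def noise_def fun_eq_iff)
  ultimately show "is_cond_distr M (PiM J (\<lambda>_. borel)) (obs (conv_output q gs gt Z) X eps J)
      (\<lambda>\<omega>. conv_output q gs gt Z Tgt xs \<omega> + eps_new \<omega>)
      (\<lambda>z. normal_law (pred_mean h q ?c n X \<sigma> xs z) (pred_var h q ?c n X \<sigma> xs))"
    unfolding mean R_var[symmetric] by simp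
  \<comment> \<open>In the residual the new observation has coefficient 1, so its noise alone bounds
    the predictive variance below by the target noise variance.\<close>
  have "0 < (joint_sd \<sigma> None)\<^sup>2" using joint_sd_pos[OF idx(1)] by simp
  also have "\<dots> \<le> (\<Sum>l\<in>insert None (Some ` J). (case_option 1 (\<lambda>p. - co p) l)\<^sup>2 * (joint_sd \<sigma> l)\<^sup>2)"
    using fin by (intro order_trans[OF _ member_le_sum[of None]]) auto
  also have "\<dots> \<le> expectation (\<lambda>\<omega>. (\<Sum>l\<in>insert None (Some ` J). case_option 1 (\<lambda>p. - co p) l * joint_obs X xs l \<omega>)\<^sup>2)"
    by (rule joint_obs_combo_lower_bound[OF K])
  also have "\<dots> = pred_var h q ?c n X \<sigma> xs"
    unfolding combo R_var[symmetric] by (simp add: sum_negf)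
  finally show "pred_var h q ?c n X \<sigma> xs > 0" .
qed

end

theorem theorem1:
  fixes M :: "'a measure"
    and q h :: nat
    and gs :: "nat \<Rightarrow> real^'d \<Rightarrow> real"
    and gt :: "label \<Rightarrow> real^'d \<Rightarrow> real"
    and Z :: "label \<Rightarrow> (real^'d \<Rightarrow> real) \<Rightarrow> 'a \<Rightarrow> real"
    and n :: "label \<Rightarrow> nat"
    and X :: "label \<Rightarrow> nat \<Rightarrow> real^'d"
    and \<sigma> :: "label \<Rightarrow> real"
    and eps :: "label \<times> nat \<Rightarrow> 'a \<Rightarrow> real"
    and eps_new :: "'a \<Rightarrow> real"
    and xs :: "real^'d"
  assumes model: "noisy_convolution_process M q gs gt Z n \<sigma> eps eps_new"
    and h_le_q: "h \<le> q"
    and zero_kernels: "\<forall>i\<in>{1..h}. \<forall>x. gt (Src i) x = 0"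
  shows
    "invertible_mat (C_plus h q (cov_f q gs gt) n X \<sigma>) \<and>
     pred_var h q (cov_f q gs gt) n X \<sigma> xs > 0 \<and>
     (\<forall>J \<in> {obs_idx (outputs q) n, obs_idx (set (idx_plus h q)) n}.
        is_cond_distr M (PiM J (\<lambda>_. borel)) (obs (conv_output q gs gt Z) X eps J)
          (\<lambda>\<omega>. conv_output q gs gt Z Tgt xs \<omega> + eps_new \<omega>)
          (\<lambda>z. normal_law (pred_mean h q (cov_f q gs gt) n X \<sigma> xs z)
                           (pred_var h q (cov_f q gs gt) n X \<sigma> xs))) \<and>
     (\<forall>gs' n' X' \<sigma>' z z'.
        (\<forall>i\<in>{h+1..q}. gs' i = gs i) \<longrightarrow>
        (\<forall>i\<in>set (idx_plus h q). n' i = n i \<and> \<sigma>' i = \<sigma> i \<and>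
           (\<forall>a<n i. X' i a = X i a \<and> z' (i, a) = z (i, a))) \<longrightarrow>
        pred_mean h q (cov_f q gs' gt) n' X' \<sigma>' xs z' = pred_mean h q (cov_f q gs gt) n X \<sigma> xs z \<and>
        pred_var h q (cov_f q gs' gt) n' X' \<sigma>' xs = pred_var h q (cov_f q gs gt) n X \<sigma> xs)"
proof -
  interpret noisy_convolution_process M q gs gt Z n \<sigma> eps eps_new by (rule model)
  note conditional = conditional_target_distribution[of h, OF zero_kernels[rule_format]]
  have C: "C_plus h q (cov_f q gs gt) n X \<sigma> \<in>
      carrier_mat (length (idx_list n (idx_plus h q))) (length (idx_list n (idx_plus h q)))"
    by (subst C_plus_eq_joint_cov[where xs = xs]) simp_all
  \<comment> \<open>Covariances between retained labels evaluate source kernels only at sources in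
    \<open>{h+1..q}\<close>; the one of the target with itself involves \<open>gt\<close>
    alone.\<close>
  have "cov_f q gs' gt i j x x' = cov_f q gs gt i j x x'"
    if "\<forall>i\<in>{h+1..q}. gs' i = gs i" "i \<in> set (idx_plus h q)" "j \<in> set (idx_plus h q)" for gs' i j x x'
    using that by (auto simp: set_idx_plus)
  note cong = prediction_cong[where h = h and q = q, OF this]
  show ?thesis
  proof (intro conjI ballI allI impI)
    show "invertible_mat (C_plus h q (cov_f q gs gt) n X \<sigma>)"
      by (rule inv_mat_of_pos_def(4)[OF C C_plus_pos_def])
    show "pred_var h q (cov_f q gs gt) n X \<sigma> xs > 0"
      by (rule conditional(2)[OF _ obs_idx_plus_subset order_refl])
  next
    fix J assume "J \<in> {obs_idx (outputs q) n, obs_idx (set (idx_plus h q)) n}"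
    \<comment> \<open>The full data and the retained data are the two extreme admissible choices of
      \<open>J\<close>.\<close>
    then show "is_cond_distr M (PiM J (\<lambda>_. borel)) (obs (conv_output q gs gt Z) X eps J)
        (\<lambda>\<omega>. conv_output q gs gt Z Tgt xs \<omega> + eps_new \<omega>)
        (\<lambda>z. normal_law (pred_mean h q (cov_f q gs gt) n X \<sigma> xs z) (pred_var h q (cov_f q gs gt) n X \<sigma> xs))"
      using obs_idx_plus_subset by (intro conditional(1)) auto
  qed (rule cong; auto)+
qed

end
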